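(* Let $G$ be a connected finite graph and let $\mathcal K(\omega,l)=\operatorname{tr}(W_{1,\omega}^l)$. Then: (a) (i) $\mathcal K(\omega,l)=\sum_{\alpha\in H_1(G,\mathbb Z)}\chi_\omega(\alpha)N(\alpha,l)$ for all $\omega\in\Omega(G)$, $l\ge1$; and (ii) $N(\alpha,l)=\frac{1}{\operatorname{vol}(\mathcal X)}\int_{\mathcal X}\chi_{-\omega}(\alpha)\mathcal K(\omega,l)\,dV_\omega$ for all $\alpha\in H_1(G,\mathbb Z)$. (b) For $\underline\alpha\in Q_\Lambda$ and $\underline\omega\in\widehat{Q_\Lambda}$: (i) $\mathcal K(\underline\omega,l)=\sum_{\underline\alpha\in Q_\Lambda}\chi_{\underline\omega}(\underline\alpha)N(\underline\alpha,l)$; and (ii) $N(\underline\alpha,l)=\frac{1}{|Q_\Lambda|}\sum_{\underline\omega\in\widehat{Q_\Lambda}}\chi_{-\underline\omega}(\underline\alpha)\mathcal K(\underline\omega,l)$.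
   Context: $G$: connected finite graph (multiple edges, loops allowed), $n$ vertices, $m$ edges; $\mathbf E(G)$ its $2m$ oriented edges, $\mathbf a(0),\mathbf a(1)$ initial/terminal vertex, $\mathbf a^{-1}$ inverse. Fix positively oriented edges $\mathbf e_1,\dots,\mathbf e_m$; $\mathcal T(G)$ = real span of the $\mathbf e_i$ (with $\mathbf e_i^{-1}=-\mathbf e_i$), $\Omega(G)$ its dual with orthonormal dual basis $d\mathbf e_i$. $H_1(G,\mathbb Z)$ = integer combinations of the $\mathbf e_i$ with zero boundary. $\mathcal H^1(G)$ = harmonic $1$-forms (at each vertex, coefficients on incoming positively oriented edges sum to those on outgoing ones); $\phi_1(\omega)$ = harmonic component of $\omega$ in the orthogonal decomposition into harmonic plus exact forms ($\sum_i(f(\mathbf e_i(1))-f(\mathbf e_i(0)))d\mathbf e_i$). $H_1(G,\mathbb Z)^\vee=\{\eta\in\mathcal H^1(G):\eta(H_1(G,\mathbb Z))\subseteq\mathbb Z\}$; $\mathcal X=\mathcal H^1(G)/H_1(G,\mathbb Z)^\vee$, $\underline\omega=\phi_1(\omega)+H_1(G,\mathbb Z)^\vee$; $dV_\omega$ = volume form on $\mathcal X$ from the inner product, $\operatorname{vol}(\mathcal X)$ the total volume. $\chi_\omega(\alpha)=\exp(2\pi\sqrt{-1}\omega(\alpha))$. $\mathbf a$ feeds into $\mathbf b$ if $\mathbf a(1)=\mathbf b(0)$ and $\mathbf b\ne\mathbf a^{-1}$; $W_{1,\omega}$ is the $2m\times2m$ matrix with $(W_{1,\omega})_{\mathbf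 a\mathbf b}=\chi_\omega(\mathbf b)$ if $\mathbf a$ feeds into $\mathbf b$, else $0$. $\mathcal K(\omega,l)$ depends only on $\underline\omega$, and is written $\mathcal K(\underline\omega,l)$. A circuit of length $N$ is a sequence of oriented edges $\mathbf a_1\cdots\mathbf a_N$ with $\mathbf a_{i+1}(0)=\mathbf a_i(1)$, $\mathbf a_N(1)=\mathbf a_1(0)$, no backtrack $\mathbf a_{i+1}=\mathbf a_i^{-1}$ and no tail $\mathbf a_N=\mathbf a_1^{-1}$; $C^{ab}=\sum\mathbf a_i\in H_1(G,\mathbb Z)$. $N(\alpha,l)$ = number of circuits of length $l$ with $C^{ab}=\alpha$. $\Lambda\subseteq H_1(G,\mathbb Z)$ a subgroup of finite index, $Q_\Lambda=H_1(G,\mathbb Z)/\Lambda$, $\underline\alpha=\alpha+\Lambda$, $N(\underline\alpha,l)$ = number of circuits of length $l$ with $C^{ab}\in\underline\alpha$; $\Lambda^\vee=\{\eta\in\mathcal H^1(G):\eta(\Lambda)\subseteq\mathbb Z\}$, $\widehat{Q_\Lambda}=\Lambda^\vee/H_1(G,\mathbb Z)^\vee\subseteq\mathcal X$, and $\chi_{\underline\omega}(\underline\alpha):=\chi_\omega(\alpha)$ for $\underline\omega\in\widehat{Q_\Lambda}$. *)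

theory Defs
  imports
    "Jordan_Normal_Form.Matrix"
    "Graph_Theory.Digraph_Component"
    "HOL-Algebra.Coset"
    "HOL-Analysis.Analysis"
begin

no_notation vec_index (infixl \<open>$\<close> 100)

text \<open>
  A finite graph (loops and multiple edges allowed) together with a choice of positively oriented
  edges is a finite multi-digraph: \<^term>\<open>arcs G\<close> are the positively oriented edges, and
  \<^term>\<open>Digraph_Component.connected G\<close> ignores the orientation.  The edges form a subset of a
  finite type, so that 1-chains and 1-forms live in \<^typ>\<open>real ^ 'e\<close>; the subset may be empty.

  An oriented edge is a pair: \<open>(e, True)\<close> is the positively oriented edge \<open>e\<close>, and \<open>(e, False)\<close> is
  its inverse (different from \<open>(e, True)\<close> also when \<open>e\<close> is a loop).
\<close>

definition oedges :: "('v, 'e) pre_digraph \<Rightarrow> ('e \<times> bool) set" where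
  "oedges G = arcs G \<times> UNIV"

definition oinit :: "('v, 'e) pre_digraph \<Rightarrow> 'e \<times> bool \<Rightarrow> 'v" where
  "oinit G a = (if snd a then tail G (fst a) else head G (fst a))"

definition oterm :: "('v, 'e) pre_digraph \<Rightarrow> 'e \<times> bool \<Rightarrow> 'v" where
  "oterm G a = (if snd a then head G (fst a) else tail G (fst a))"

definition oinv :: "'e \<times> bool \<Rightarrow> 'e \<times> bool" where
  "oinv a = (fst a, \<not> snd a)"

definition feeds :: "('v, 'e) pre_digraph \<Rightarrow> 'e \<times> bool \<Rightarrow> 'e \<times> bool \<Rightarrow> bool" where
  "feeds G a b \<longleftrightarrow> oterm G a = oinit G b \<and> b \<noteq> oinv a"


section \<open>Chains, 1-forms and homology\<close>

definition ovec :: "'e \<times> bool \<Rightarrow> real ^ 'e" where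
  "ovec a = (if snd a then axis (fst a) 1 else - axis (fst a) 1)"

text \<open>
  Elements of the chain space are given by their coordinates with respect to the positively
  oriented edges, 1-forms by their coordinates with respect to the dual basis.  The latter being
  orthonormal, the inner product of 1-forms is the standard one of \<^typ>\<open>real ^ 'e\<close>.
\<close>

definition chains :: "('v, 'e::finite) pre_digraph \<Rightarrow> (real ^ 'e) set" where
  "chains G = span ((\<lambda>e. axis e 1) ` arcs G)"

definition forms :: "('v, 'e::finite) pre_digraph \<Rightarrow> (real ^ 'e) set" where
  "forms G = {\<omega>. \<forall>e. e \<notin> arcs G \<longrightarrow> \<omega> $ e = 0}"

definition pairing :: "('v, 'e::finite) pre_digraph \<Rightarrow> real ^ 'e \<Rightarrow> real ^ 'e \<Rightarrow> real" where
  "pairing G \<omega> \<alpha> = (\<Sum>e\<in>arcs G. \<omega> $ e * \<alpha> $ e)"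

definition boundary :: "('v, 'e::finite) pre_digraph \<Rightarrow> real ^ 'e \<Rightarrow> 'v \<Rightarrow> real" where
  "boundary G \<alpha> v =
     (\<Sum>e | e \<in> arcs G \<and> head G e = v. \<alpha> $ e) - (\<Sum>e | e \<in> arcs G \<and> tail G e = v. \<alpha> $ e)"

definition H1 :: "('v, 'e::finite) pre_digraph \<Rightarrow> (real ^ 'e) set" where
  "H1 G = {\<alpha> \<in> chains G. (\<forall>e\<in>arcs G. \<alpha> $ e \<in> \<int>) \<and> (\<forall>v\<in>verts G. boundary G \<alpha> v = 0)}"

definition harmonic :: "('v, 'e::finite) pre_digraph \<Rightarrow> (real ^ 'e) set" where
  "harmonic G = {\<omega> \<in> forms G. \<forall>v\<in>verts G.
     (\<Sum>e | e \<in> arcs G \<and> head G e = v. \<omega> $ e) = (\<Sum>e | e \<in> arcs G \<and> tail G e = v. \<omega> $ e)}"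

definition dform :: "('v, 'e::finite) pre_digraph \<Rightarrow> ('v \<Rightarrow> real) \<Rightarrow> real ^ 'e" where
  "dform G f = (\<chi> e. if e \<in> arcs G then f (head G e) - f (tail G e) else 0)"

definition exact :: "('v, 'e::finite) pre_digraph \<Rightarrow> (real ^ 'e) set" where
  "exact G = range (dform G)"

definition phi1 :: "('v, 'e::finite) pre_digraph \<Rightarrow> real ^ 'e \<Rightarrow> real ^ 'e" where
  "phi1 G \<omega> = (THE \<eta>. \<eta> \<in> harmonic G \<and> \<omega> - \<eta> \<in> exact G)"

definition dual :: "('v, 'e::finite) pre_digraph \<Rightarrow> (real ^ 'e) set \<Rightarrow> (real ^ 'e) set" where
  "dual G \<Lambda> = {\<eta> \<in> harmonic G. \<forall>\<alpha>\<in>\<Lambda>. pairing G \<eta> \<alpha> \<in> \<int>}"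


section \<open>Quotient groups\<close>

definition add_grp :: "'a::ab_group_add set \<Rightarrow> 'a monoid" where
  "add_grp S = \<lparr>carrier = S, monoid.mult = (+), one = 0\<rparr>"

definition X_grp :: "('v, 'e::finite) pre_digraph \<Rightarrow> (real ^ 'e) set monoid" where
  "X_grp G = add_grp (harmonic G) Mod dual G (H1 G)"

definition uline :: "('v, 'e::finite) pre_digraph \<Rightarrow> real ^ 'e \<Rightarrow> (real ^ 'e) set" where
  "uline G \<omega> = dual G (H1 G) #>\<^bsub>add_grp (harmonic G)\<^esub> phi1 G \<omega>"

definition Q_grp :: "('v, 'e::finite) pre_digraph \<Rightarrow> (real ^ 'e) set \<Rightarrow> (real ^ 'e) set monoid" where
  "Q_grp G \<Lambda> = add_grp (H1 G) Mod \<Lambda>"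

definition Qhat_grp :: "('v, 'e::finite) pre_digraph \<Rightarrow> (real ^ 'e) set \<Rightarrow> (real ^ 'e) set monoid" where
  "Qhat_grp G \<Lambda> = add_grp (dual G \<Lambda>) Mod dual G (H1 G)"


section \<open>Volume on quotients of subspaces by lattices\<close>

text \<open>
  Lebesgue measure on a subspace with the inner product of the ambient space, transported from
  coordinates with respect to an orthonormal basis (the choice does not matter).  For the zero
  subspace it is the unit point mass.
\<close>

definition subspace_lebesgue :: "'a::euclidean_space set \<Rightarrow> 'a measure" where
  "subspace_lebesgue S =
     (let B = (SOME B. B \<subseteq> S \<and> pairwise orthogonal B \<and> (\<forall>b\<in>B. norm b = 1) \<and> span B = S)
      in distr (Pi\<^sub>M B (\<lambda>_. lborel)) (restrict_space borel S) (\<lambda>c. \<Sum>b\<in>B. c b *\<^sub>R b))"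

definition fundamental_domain :: "'a::euclidean_space set \<Rightarrow> 'a set \<Rightarrow> 'a set \<Rightarrow> bool" where
  "fundamental_domain S L D \<longleftrightarrow>
     D \<subseteq> S \<and> bounded D \<and> D \<in> sets borel \<and> (\<forall>x\<in>S. \<exists>!d. d \<in> D \<and> x - d \<in> L)"

text \<open>
  The Riemannian volume of \<open>S / L\<close> for a lattice \<open>L\<close> in \<open>S\<close>: the quotient map preserves measure on
  Borel sets on which it is injective, so the volume is the image of the measure on any fundamental
  domain.  A set of cosets is measurable iff its preimage, which is its union, is Borel.
\<close>

definition torus_measure :: "'a::euclidean_space set \<Rightarrow> 'a set \<Rightarrow> 'a set measure" where
  "torus_measure S L =
     (let X = carrier (add_grp S Mod L)
      in distr (restrict_space (subspace_lebesgue S) (SOME D. fundamental_domain S L D))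
           (sigma X {A. A \<subseteq> X \<and> \<Union>A \<in> sets borel})
           (\<lambda>x. L #>\<^bsub>add_grp S\<^esub> x))"

definition dV :: "('v, 'e::finite) pre_digraph \<Rightarrow> (real ^ 'e) set measure" where
  "dV G = torus_measure (harmonic G) (dual G (H1 G))"

definition vol_X :: "('v, 'e::finite) pre_digraph \<Rightarrow> real" where
  "vol_X G = measure (dV G) (carrier (X_grp G))"


section \<open>The twisted edge adjacency matrix\<close>

definition chi :: "('v, 'e::finite) pre_digraph \<Rightarrow> real ^ 'e \<Rightarrow> real ^ 'e \<Rightarrow> complex" where
  "chi G \<omega> \<alpha> = exp (2 * of_real pi * \<i> * of_real (pairing G \<omega> \<alpha>))"

text \<open>
  Rows and columns of the matrix are indexed by oriented edges through an enumeration of them,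
  whose choice does not affect traces.
\<close>

definition oedge_enum :: "('v, 'e) pre_digraph \<Rightarrow> nat \<Rightarrow> 'e \<times> bool" where
  "oedge_enum G = (SOME h. bij_betw h {0..<2 * card (arcs G)} (oedges G))"

definition W1 :: "('v, 'e::finite) pre_digraph \<Rightarrow> real ^ 'e \<Rightarrow> complex Matrix.mat" where
  "W1 G \<omega> = Matrix.mat (2 * card (arcs G)) (2 * card (arcs G))
     (\<lambda>(i, j). if feeds G (oedge_enum G i) (oedge_enum G j)
               then chi G \<omega> (ovec (oedge_enum G j)) else 0)"

definition mat_trace :: "'a::comm_monoid_add Matrix.mat \<Rightarrow> 'a" where
  "mat_trace A = sum_list (diag_mat A)"

definition K :: "('v, 'e::finite) pre_digraph \<Rightarrow> real ^ 'e \<Rightarrow> nat \<Rightarrow> complex" where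
  "K G \<omega> l = mat_trace (W1 G \<omega> ^\<^sub>m l)"

text \<open>
  The common value of \<open>f\<close> on all 1-forms with class \<open>x\<close>; all functions it is applied to depend only
  on the class.
\<close>

definition on_class :: "('v, 'e::finite) pre_digraph \<Rightarrow> (real ^ 'e \<Rightarrow> 'b) \<Rightarrow> (real ^ 'e) set \<Rightarrow> 'b" where
  "on_class G f x = (THE z. \<forall>\<omega>\<in>forms G. uline G \<omega> = x \<longrightarrow> f \<omega> = z)"

definition K_cls :: "('v, 'e::finite) pre_digraph \<Rightarrow> (real ^ 'e) set \<Rightarrow> nat \<Rightarrow> complex" where
  "K_cls G x l = on_class G (\<lambda>\<omega>. K G \<omega> l) x"

definition chi_cls ::
  "('v, 'e::finite) pre_digraph \<Rightarrow> (real ^ 'e) set \<Rightarrow> (real ^ 'e) set \<Rightarrow> complex" where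
  "chi_cls G x c = (THE z. \<forall>\<omega>\<in>forms G. \<forall>\<alpha>\<in>c. uline G \<omega> = x \<longrightarrow> chi G \<omega> \<alpha> = z)"


section \<open>Circuits\<close>

definition circuits :: "('v, 'e) pre_digraph \<Rightarrow> nat \<Rightarrow> ('e \<times> bool) list set" where
  "circuits G l = {as. as \<noteq> [] \<and> length as = l \<and> set as \<subseteq> oedges G \<and>
     (\<forall>i. Suc i < l \<longrightarrow> oinit G (as ! Suc i) = oterm G (as ! i) \<and> as ! Suc i \<noteq> oinv (as ! i)) \<and>
     oterm G (last as) = oinit G (hd as) \<and> last as \<noteq> oinv (hd as)}"

definition Cab :: "('e::finite \<times> bool) list \<Rightarrow> real ^ 'e" where
  "Cab as = sum_list (map ovec as)"

definition Ncirc :: "('v, 'e::finite) pre_digraph \<Rightarrow> real ^ 'e \<Rightarrow> nat \<Rightarrow> nat" where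
  "Ncirc G \<alpha> l = card {as \<in> circuits G l. Cab as = \<alpha>}"

definition Ncirc_cls :: "('v, 'e::finite) pre_digraph \<Rightarrow> (real ^ 'e) set \<Rightarrow> nat \<Rightarrow> nat" where
  "Ncirc_cls G c l = card {as \<in> circuits G l. Cab as \<in> c}"

end

theory Submission
  imports Defs "HOL-Algebra.Multiplicative_Group"
begin

no_notation scalar_prod (infix \<open>\<bullet>\<close> 70)

text \<open>
  Expanding the trace of a power of the twisted matrix gives the sum of the character over all
  circuits, and everything else is Fourier inversion.  On the torus, orthogonality of characters
  follows from translation invariance of integrals over fundamental domains; it applies because
  \<^term>\<open>H1 G\<close> is a full lattice in \<^term>\<open>harmonic G\<close>, which Dirichlet approximation shows.
  On the finite quotient, the character group separates points because a lattice with a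
  \<open>\<int>\<close>-basis is its own double dual.
\<close>

section \<open>Subgroups of integer vectors\<close>

text \<open>Both inversions rest on one reduction. An exact form pairs to zero with a cycle, so for
  \<alpha> in \<open>H1 G\<close> the value \<open>chi G \<omega> \<alpha>\<close> depends only on
  the harmonic part of \<omega>, and on that part only modulo the dual lattice. The trace becomes a
  finite sum of terms \<open>unit_char \<eta> (Cab as)\<close>, and inversion counts the circuits
  for which \<open>Cab as - \<alpha>\<close> is 0, or lies in \<Lambda>. The obstacle on the torus
  is that its measure is pushed forward from a fundamental domain picked by choice, about which
  nothing else is known. The measure is therefore first shown to be the same for every domain, by
  cutting one domain along the translates of another. This freedom is also the source of translation
  invariance: a translated domain is again a fundamental domain. A bounded domain for the dual
  lattice exists because \<open>H1 G\<close> has an integer basis that is a real basis of the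
  harmonic forms. Spanning is obtained by approximation, without choosing a spanning tree: a
  rational vector close enough to a cycle is itself a cycle.\<close>

lemma int_subgroup_generator:
  fixes S :: "int set"
  assumes "0 \<in> S" and diff: "\<And>x y. x \<in> S \<Longrightarrow> y \<in> S \<Longrightarrow> x - y \<in> S"
  obtains d where "d \<in> S" "\<And>x. x \<in> S \<Longrightarrow> d dvd x"
proof (cases "S = {0}")
  case True
  then show ?thesis using that by auto
next
  case False
  have neg: "- x \<in> S" if "x \<in> S" for x
    using diff[OF assms(1) that] by simp
  have mult: "int k * x \<in> S" if "x \<in> S" for x k
  proof (induction k)
    case (Suc k)
    have "int k * x - (- x) \<in> S" by (rule diff[OF Suc neg[OF that]])
    then show ?case by (simp add: algebra_simps)
  qed (use assms in simp)
  have zmult: "k * x \<in> S" if "x \<in> S" for x k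
    by (cases k rule: int_cases2) (use mult[OF that] neg in auto)
  define P where "P n \<longleftrightarrow> n > 0 \<and> int n \<in> S" for n
  obtain s where s: "s \<in> S" "s \<noteq> 0" using False assms(1) by auto
  have "P (nat \<bar>s\<bar>)" using s neg[OF s(1)] by (auto simp: P_def abs_if)
  then have PL: "P (LEAST n. P n)" by (rule LeastI)
  \<comment> \<open>The least positive element divides every other one, since a nonzero remainder
    would be a smaller positive element.\<close>
  define d where "d = int (LEAST n. P n)"
  have d: "d > 0" "d \<in> S" using PL by (auto simp: P_def d_def)
  have "d dvd x" if "x \<in> S" for x
  proof -
    have "x mod d = x - (x div d) * d" by (simp add: minus_div_mult_eq_mod)
    then have m: "x mod d \<in> S" using diff[OF that zmult[OF d(2)]] by simp
    have "x mod d = 0"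
    proof (rule ccontr)
      assume "x mod d \<noteq> 0"
      then have pos: "x mod d > 0" using d(1) by (simp add: order_less_le)
      then have "P (nat (x mod d))" using m by (simp add: P_def)
      then have "(LEAST n. P n) \<le> nat (x mod d)" by (rule Least_le)
      then show False using pos d(1) pos_mod_bound[OF d(1), of x] unfolding d_def by linarith
    qed
    then show ?thesis by auto
  qed
  then show ?thesis using that d(2) by blast
qed

definition int_comb :: "'a::real_vector set \<Rightarrow> 'a set" where
  "int_comb B = {\<Sum>b\<in>B. of_int (c b) *\<^sub>R b | c. True}"

lemma int_comb_subset_span: "int_comb B \<subseteq> span B"
proof
  fix x assume "x \<in> int_comb B"
  then obtain c where "x = (\<Sum>b\<in>B. of_int (c b) *\<^sub>R b)" by (auto simp: int_comb_def)
  then show "x \<in> span B" by (simp add: span_sum span_scale span_base)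
qed

lemma base_in_int_comb:
  assumes "finite B" "b \<in> B"
  shows "b \<in> int_comb B"
proof -
  have "b = (\<Sum>b'\<in>B. of_int (if b' = b then 1 else 0) *\<^sub>R b')"
    using assms by (simp add: if_distrib[of "\<lambda>c. of_int c *\<^sub>R _"] sum.delta cong: if_cong)
  then show ?thesis unfolding int_comb_def
    by (intro CollectI exI[of _ "\<lambda>b'. if b' = b then 1 else 0"] conjI TrueI)
qed

text \<open>
  The basis is built one coordinate at a time: the values of a coordinate on \<open>\<Lambda>\<close> form a cyclic
  group, and a vector attaining a generator splits off the kernel of the coordinate.
\<close>
lemma integral_subgroup_basis:
  fixes \<Lambda> :: "(real ^ 'e::finite) set"
  assumes "0 \<in> \<Lambda>" "\<And>x y. x \<in> \<Lambda> \<Longrightarrow> y \<in> \<Lambda> \<Longrightarrow> x - y \<in> \<Lambda>"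
    and "\<And>x e. x \<in> \<Lambda> \<Longrightarrow> x $ e \<in> \<int>"
  obtains B where "finite B" "independent B" "\<Lambda> = int_comb B"
proof -
  \<comment> \<open>The claim is generalised to every subgroup supported on F, because the kernel of
    a coordinate is such a subgroup with smaller support.\<close>
  have "\<exists>B. finite B \<and> independent B \<and> \<Lambda> = int_comb B"
    if "finite F" "\<forall>x\<in>\<Lambda>. \<forall>e. e \<notin> F \<longrightarrow> x $ e = 0" "0 \<in> \<Lambda>"
      "\<And>x y. x \<in> \<Lambda> \<Longrightarrow> y \<in> \<Lambda> \<Longrightarrow> x - y \<in> \<Lambda>"
      "\<And>x e. x \<in> \<Lambda> \<Longrightarrow> x $ e \<in> \<int>" for F and \<Lambda> :: "(real ^ 'e) set"
    using that
  proof (induction F arbitrary: \<Lambda> rule: finite_induct)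
    case empty
    then have "\<Lambda> = {0}" by (auto simp: vec_eq_iff)
    then show ?case by (intro exI[of _ "{}"]) (auto simp: int_comb_def independent_empty)
  next
    case (insert e F)
    note diff = insert.prems(3) and int = insert.prems(4)
    have neg: "- x \<in> \<Lambda>" if "x \<in> \<Lambda>" for x
      using diff[OF insert.prems(2) that] by simp
    have mult: "real k *\<^sub>R x \<in> \<Lambda>" if "x \<in> \<Lambda>" for x k
    proof (induction k)
      case (Suc k)
      have "real k *\<^sub>R x - (- x) \<in> \<Lambda>" by (rule diff[OF Suc neg[OF that]])
      then show ?case by (simp add: algebra_simps)
    qed (use insert.prems(2) in simp)
    have zmult: "of_int k *\<^sub>R x \<in> \<Lambda>" if "x \<in> \<Lambda>" for x k
      by (cases k rule: int_cases2) (use mult[OF that] neg in auto)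
    define Z where "Z = {k :: int. \<exists>x\<in>\<Lambda>. x $ e = of_int k}"
    have "0 \<in> Z" using insert.prems(2) by (auto simp: Z_def intro!: bexI[of _ 0])
    moreover have "x - y \<in> Z" if xy: "x \<in> Z" "y \<in> Z" for x y
    proof -
      obtain a b where "a \<in> \<Lambda>" "a $ e = of_int x" "b \<in> \<Lambda>" "b $ e = of_int y"
        using xy by (auto simp: Z_def)
      then show ?thesis unfolding Z_def using diff[of a b] by (auto intro!: bexI[of _ "a - b"])
    qed
    ultimately obtain d where d: "d \<in> Z" "\<And>x. x \<in> Z \<Longrightarrow> d dvd x"
      using int_subgroup_generator by blast
    define \<Lambda>0 where "\<Lambda>0 = {x \<in> \<Lambda>. x $ e = 0}"
    have "\<exists>B. finite B \<and> independent B \<and> \<Lambda>0 = int_comb B"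
    proof (rule insert.IH)
      show "\<forall>x\<in>\<Lambda>0. \<forall>i. i \<notin> F \<longrightarrow> x $ i = 0"
        using insert.prems(1) by (auto simp: \<Lambda>0_def)
    qed (use insert.prems in \<open>auto simp: \<Lambda>0_def\<close>)
    then obtain B where B: "finite B" "independent B" "\<Lambda>0 = int_comb B" by blast
    have B0: "b $ e = 0" if "b \<in> B" for b
    proof -
      have "b \<in> int_comb B" by (rule base_in_int_comb[OF B(1) that])
      then have "b \<in> \<Lambda>0" using B(3) by simp
      then show ?thesis by (simp add: \<Lambda>0_def)
    qed
    show ?case
    \<comment> \<open>A zero generator means that the coordinate vanishes on \<Lambda>, so the
      kernel is all of \<Lambda> and its basis already suffices.\<close>
    proof (cases "d = 0")
      case True
      then have "x $ e = 0" if "x \<in> \<Lambda>" for x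
      proof -
        obtain k where "x $ e = of_int k" using int[OF \<open>x \<in> \<Lambda>\<close>] by (auto elim: Ints_cases)
        moreover from this have "k \<in> Z" using that by (auto simp: Z_def)
        ultimately show ?thesis using d(2) True by auto
      qed
      then have "\<Lambda>0 = \<Lambda>" by (auto simp: \<Lambda>0_def)
      then show ?thesis using B by blast
    next
      case False
      obtain v where v: "v \<in> \<Lambda>" "v $ e = of_int d" using d(1) by (auto simp: Z_def)
      \<comment> \<open>The span of B lies in the kernel of the coordinate, whereas v has the value
        \<open>d \<noteq> 0\<close> there; hence \<open>insert v B\<close> stays
        independent.\<close>
      have "x $ e = 0" if "x \<in> span B" for x
        using that
      proof (induction rule: span_induct_alt)
        case (step c x y)
        then show ?case using B0 by simp
      qed simp
      then have nv: "v \<notin> span B" using v False by auto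
      then have vB: "v \<notin> B" using span_base by blast
      have ind: "independent (insert v B)" using nv B(2) by (simp add: independent_insert)
      have "\<Lambda> = int_comb (insert v B)"
      proof (intro equalityI subsetI)
        fix x assume x: "x \<in> \<Lambda>"
        obtain k where k: "x $ e = of_int k" using int[OF x] by (auto elim: Ints_cases)
        then have "k \<in> Z" using x by (auto simp: Z_def)
        then obtain j where j: "k = d * j" using d(2) by blast
        have "x - of_int j *\<^sub>R v \<in> \<Lambda>0"
          unfolding \<Lambda>0_def using diff[OF x zmult[OF v(1)]] k j v by simp
        then obtain c where c: "x - of_int j *\<^sub>R v = (\<Sum>b\<in>B. of_int (c b) *\<^sub>R b)"
          using B(3) by (auto simp: int_comb_def)
        have "x = (\<Sum>b\<in>insert v B. of_int ((c(v := j)) b) *\<^sub>R b)"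
        proof -
          have "(\<Sum>b\<in>B. of_int ((c(v := j)) b) *\<^sub>R b) = (\<Sum>b\<in>B. of_int (c b) *\<^sub>R b)"
            by (rule sum.cong) (use vB in auto)
          then show ?thesis using c B(1) vB by (simp add: algebra_simps)
        qed
        then show "x \<in> int_comb (insert v B)" unfolding int_comb_def by blast
      next
        fix x assume "x \<in> int_comb (insert v B)"
        then obtain c where c: "x = of_int (c v) *\<^sub>R v + (\<Sum>b\<in>B. of_int (c b) *\<^sub>R b)"
          using B(1) vB by (auto simp: int_comb_def)
        have "(\<Sum>b\<in>B. of_int (c b) *\<^sub>R b) \<in> \<Lambda>0" using B(3) by (auto simp: int_comb_def)
        then have "(\<Sum>b\<in>B. of_int (c b) *\<^sub>R b) \<in> \<Lambda>" by (simp add: \<Lambda>0_def)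
        then have "of_int (c v) *\<^sub>R v - - (\<Sum>b\<in>B. of_int (c b) *\<^sub>R b) \<in> \<Lambda>"
          by (intro diff zmult v neg)
        then show "x \<in> \<Lambda>" using c by simp
      qed
      then show ?thesis using ind B(1) by blast
    qed
  qed
  from this[of UNIV \<Lambda>] assms obtain B where "finite B" "independent B" "\<Lambda> = int_comb B" by auto
  then show ?thesis using that by blast
qed

text \<open>Simultaneous Dirichlet approximation, transported along an enumeration of the
  coordinates. The last conclusion keeps the approximant of a form supported on the arcs; it holds
  because an integer of absolute value below \<open>1 / N \<le> 1\<close> is 0.\<close>

lemma vec_Dirichlet_approx:
  fixes x :: "real ^ 'e::finite"
  assumes "N > (0 :: nat)"
  obtains q :: int and p :: "real ^ 'e"
  where "q > 0" "\<And>e. p $ e \<in> \<int>" "\<And>e. \<bar>of_int q * x $ e - p $ e\<bar> < 1 / N"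
    "\<And>e. x $ e = 0 \<Longrightarrow> p $ e = 0"
proof -
  obtain h where h: "bij_betw h {0..<CARD('e)} (UNIV :: 'e set)"
    using ex_bij_betw_nat_finite[of "UNIV :: 'e set"] by auto
  obtain q :: int and p where qp: "0 < q" "\<And>i. i < CARD('e) \<Longrightarrow> \<bar>of_int q * x $ h i - of_int (p i)\<bar> < 1 / N"
    using Dirichlet_approx_simult[OF assms, of "CARD('e)" "\<lambda>i. x $ h i"] by metis
  define g where "g = the_inv_into {0..<CARD('e)} h"
  have g: "g e < CARD('e)" "h (g e) = e" for e
    using h f_the_inv_into_f_bij_betw[OF h, of e] bij_betw_the_inv_into[OF h]
    by (auto simp: g_def bij_betw_def)
  define p' :: "real ^ 'e" where "p' = (\<chi> e. of_int (p (g e)))"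
  have a: "\<bar>of_int q * x $ e - p' $ e\<bar> < 1 / N" for e
    using qp(2)[OF g(1), of e] g(2)[of e] by (simp add: p'_def)
  show ?thesis
  proof (rule that[of q p'])
    show "p' $ e = 0" if "x $ e = 0" for e
    proof -
      have "\<bar>of_int (p (g e)) :: real\<bar> < 1 / N" using a[of e] that by (simp add: p'_def)
      also have "\<dots> \<le> 1" using assms by simp
      finally show ?thesis by (simp add: p'_def)
    qed
  qed (use qp a in \<open>auto simp: p'_def\<close>)
qed

section \<open>Lebesgue measure on subspaces and tori\<close>

text \<open>Exposes the basis picked by choice through its orthonormality alone, which is all that
  the later arguments may rely on.\<close>

lemma subspace_lebesgue_orthonormal:
  assumes "subspace S"
  obtains B where "finite B" "B \<subseteq> S" "pairwise orthogonal B" "\<And>b. b \<in> B \<Longrightarrow> norm b = 1" "span B = S"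
    "subspace_lebesgue S =
      distr (Pi\<^sub>M B (\<lambda>_. lborel)) (restrict_space borel S) (\<lambda>c. \<Sum>b\<in>B. c b *\<^sub>R b)"
proof -
  define P where "P B \<longleftrightarrow> B \<subseteq> S \<and> pairwise orthogonal B \<and> (\<forall>b\<in>B. norm b = 1) \<and> span B = S" for B
  have "\<exists>B. P B" using orthonormal_basis_subspace[OF assms] unfolding P_def by metis
  define B where "B = (SOME B. P B)"
  have P: "P B" unfolding B_def by (rule someI_ex) fact
  then have "0 \<notin> B" by (auto simp: P_def)
  then have "independent B"
    using P pairwise_orthogonal_independent[of B] by (simp add: P_def)
  then have "finite B" by (rule independent_imp_finite)
  moreover have "subspace_lebesgue S =
      distr (Pi\<^sub>M B (\<lambda>_. lborel)) (restrict_space borel S) (\<lambda>c. \<Sum>b\<in>B. c b *\<^sub>R b)"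
    unfolding subspace_lebesgue_def B_def P_def Let_def ..
  ultimately show ?thesis using that[of B] P by (auto simp: P_def)
qed

lemma orthonormal_comb_measurable:
  fixes B :: "'a::euclidean_space set"
  assumes "B \<subseteq> S" "subspace S"
  shows "(\<lambda>c. \<Sum>b\<in>B. c b *\<^sub>R b) \<in> Pi\<^sub>M B (\<lambda>_. lborel) \<rightarrow>\<^sub>M restrict_space borel S"
proof (rule measurable_restrict_space2)
  show "(\<lambda>c. \<Sum>b\<in>B. c b *\<^sub>R b) \<in> space (Pi\<^sub>M B (\<lambda>_. lborel)) \<rightarrow> S"
    using assms by (auto intro!: subspace_sum subspace_scale)
qed measurable

lemma sets_subspace_lebesgue [simp, measurable_cong]:
  "subspace S \<Longrightarrow> sets (subspace_lebesgue S) = sets (restrict_space borel S)"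
  by (rule subspace_lebesgue_orthonormal[of S]) auto

lemma space_subspace_lebesgue [simp]:
  "subspace S \<Longrightarrow> space (subspace_lebesgue S) = S"
  by (rule subspace_lebesgue_orthonormal[of S]) (auto simp: space_restrict_space)

lemma in_sets_subspace_lebesgue:
  fixes S :: "'a::euclidean_space set"
  assumes "subspace S" "A \<subseteq> S" "A \<in> sets borel"
  shows "A \<in> sets (subspace_lebesgue S)"
  using assms closed_subspace[OF assms(1)] by (simp add: sets_restrict_space_iff)

lemma sets_subspace_lebesgue_borel:
  fixes S :: "'a::euclidean_space set"
  assumes "subspace S" "A \<in> sets (subspace_lebesgue S)"
  shows "A \<subseteq> S" "A \<in> sets borel"
  using assms closed_subspace[OF assms(1)] by (simp_all add: sets_restrict_space_iff)

text \<open>The product measure is determined by its values on boxes, and there invariance holds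
  factor by factor. The restriction to B keeps shifted functions extensional, as elements of the
  product space have to be.\<close>

lemma distr_PiM_lborel_shift:
  fixes t :: "'i \<Rightarrow> real"
  assumes "finite B"
  shows "distr (Pi\<^sub>M B (\<lambda>_. lborel)) (Pi\<^sub>M B (\<lambda>_. lborel)) (\<lambda>c. \<lambda>b\<in>B. c b + t b) = Pi\<^sub>M B (\<lambda>_. lborel)"
proof -
  interpret product_sigma_finite "\<lambda>_ :: 'i. lborel :: real measure" by standard
  show ?thesis
  proof (rule PiM_eqI[OF assms])
    fix A :: "'i \<Rightarrow> real set"
    assume A: "\<And>i. i \<in> B \<Longrightarrow> A i \<in> sets lborel"
    have m: "(\<lambda>c. \<lambda>b\<in>B. c b + t b) \<in> Pi\<^sub>M B (\<lambda>_. lborel) \<rightarrow>\<^sub>M Pi\<^sub>M B (\<lambda>_. lborel :: real measure)"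
      by (rule measurable_restrict) measurable
    have "Pi\<^sub>E B A \<in> sets (Pi\<^sub>M B (\<lambda>_. lborel))"
      by (rule sets_PiM_I_finite[OF assms A])
    then have "emeasure (distr (Pi\<^sub>M B (\<lambda>_. lborel)) (Pi\<^sub>M B (\<lambda>_. lborel)) (\<lambda>c. \<lambda>b\<in>B. c b + t b)) (Pi\<^sub>E B A)
      = emeasure (Pi\<^sub>M B (\<lambda>_. lborel))
          ((\<lambda>c. \<lambda>b\<in>B. c b + t b) -` Pi\<^sub>E B A \<inter> space (Pi\<^sub>M B (\<lambda>_. lborel)))"
      by (rule emeasure_distr[OF m])
    also have "(\<lambda>c. \<lambda>b\<in>B. c b + t b) -` Pi\<^sub>E B A \<inter> space (Pi\<^sub>M B (\<lambda>_. lborel))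
      = Pi\<^sub>E B (\<lambda>b. (\<lambda>x. x + t b) -` A b)"
      by (auto simp: space_PiM PiE_def Pi_def extensional_def)
    also have "emeasure (Pi\<^sub>M B (\<lambda>_. lborel)) \<dots> = (\<Prod>b\<in>B. emeasure lborel ((\<lambda>x. x + t b) -` A b))"
    proof (rule emeasure_PiM[OF assms])
      fix i assume "i \<in> B"
      have "(\<lambda>x. x + t i) \<in> borel_measurable borel" by measurable
      from measurable_sets[OF this] A[OF \<open>i \<in> B\<close>] show "(\<lambda>x. x + t i) -` A i \<in> sets lborel" by simp
    qed
    also have "\<dots> = (\<Prod>b\<in>B. emeasure lborel (A b))"
    proof (rule prod.cong[OF refl])
      fix b assume b: "b \<in> B"
      have "emeasure (distr lborel borel (\<lambda>x. t b + x)) (A b) = emeasure lborel ((\<lambda>x. x + t b) -` A b)"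
        using A[OF b] by (subst emeasure_distr) (auto simp: add.commute[of _ "t b"])
      then show "emeasure lborel ((\<lambda>x. x + t b) -` A b) = emeasure lborel (A b)"
        by (simp add: lborel_distr_plus)
    qed
    finally show "emeasure (distr (Pi\<^sub>M B (\<lambda>_. lborel)) (Pi\<^sub>M B (\<lambda>_. lborel)) (\<lambda>c. \<lambda>b\<in>B. c b + t b)) (Pi\<^sub>E B A)
      = (\<Prod>b\<in>B. emeasure lborel (A b))" .
  qed simp
qed

lemma orthonormal_inner_comb:
  assumes "finite B" "pairwise orthogonal B" "\<And>b. b \<in> B \<Longrightarrow> norm b = 1" "b \<in> B"
  shows "(\<Sum>b\<in>B. c b *\<^sub>R b) \<bullet> b = c b"
proof -
  have "(\<Sum>b\<in>B. c b *\<^sub>R b) \<bullet> b = (\<Sum>b'\<in>B. c b' * (b' \<bullet> b))" by (simp add: inner_sum_left)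
  also have "\<dots> = (\<Sum>b'\<in>B. if b' = b then c b else 0)"
    using assms by (intro sum.cong) (auto simp: pairwise_def orthogonal_def dot_square_norm)
  finally show ?thesis using assms by simp
qed

text \<open>In orthonormal coordinates, adding v is the shift by the coordinates t of v, so
  invariance is inherited from the product measure.\<close>

lemma subspace_lebesgue_translate:
  fixes S :: "'a::euclidean_space set"
  assumes S: "subspace S" and v: "v \<in> S"
  shows "distr (subspace_lebesgue S) (restrict_space borel S) (\<lambda>x. x + v) = subspace_lebesgue S"
proof -
  obtain B where B: "finite B" "B \<subseteq> S" "pairwise orthogonal B" "\<And>b. b \<in> B \<Longrightarrow> norm b = 1" "span B = S"
    and eq: "subspace_lebesgue S =
      distr (Pi\<^sub>M B (\<lambda>_. lborel)) (restrict_space borel S) (\<lambda>c. \<Sum>b\<in>B. c b *\<^sub>R b)"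
    using subspace_lebesgue_orthonormal[OF S] by blast
  let ?P = "Pi\<^sub>M B (\<lambda>_. lborel) :: ('a \<Rightarrow> real) measure" and ?R = "restrict_space borel S"
  let ?\<phi> = "\<lambda>c. \<Sum>b\<in>B. c b *\<^sub>R b"
  obtain t where t: "v = ?\<phi> t" using v B(1,5) span_finite[OF B(1)] by auto
  have \<phi>: "?\<phi> \<in> ?P \<rightarrow>\<^sub>M ?R" by (rule orthonormal_comb_measurable[OF B(2) S])
  have plus: "(\<lambda>x. x + v) \<in> ?R \<rightarrow>\<^sub>M ?R"
  proof (rule measurable_restrict_space2)
    show "(\<lambda>x. x + v) \<in> space ?R \<rightarrow> S" using S v by (auto simp: space_restrict_space subspace_add)
    show "(\<lambda>x. x + v) \<in> borel_measurable ?R" by (rule measurable_restrict_space1) measurable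
  qed
  have sh: "(\<lambda>c. \<lambda>b\<in>B. c b + t b) \<in> ?P \<rightarrow>\<^sub>M ?P" by (rule measurable_restrict) measurable
  have "distr (distr ?P ?R ?\<phi>) ?R (\<lambda>x. x + v) = distr ?P ?R ((\<lambda>x. x + v) \<circ> ?\<phi>)"
    by (rule distr_distr[OF plus \<phi>])
  also have "(\<lambda>x. x + v) \<circ> ?\<phi> = ?\<phi> \<circ> (\<lambda>c. \<lambda>b\<in>B. c b + t b)"
    by (auto simp: t scaleR_add_left sum.distrib fun_eq_iff)
  also have "distr ?P ?R \<dots> = distr (distr ?P ?P (\<lambda>c. \<lambda>b\<in>B. c b + t b)) ?R ?\<phi>"
    by (rule distr_distr[OF \<phi> sh, symmetric])
  also have "\<dots> = distr ?P ?R ?\<phi>" by (simp only: distr_PiM_lborel_shift[OF B(1)])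
  finally show ?thesis using eq by simp
qed

text \<open>The translate is treated as a preimage under subtraction of v; its measurability and its
  measure then both come from the pushforward identity.\<close>

lemma emeasure_subspace_lebesgue_translate:
  fixes S :: "'a::euclidean_space set"
  assumes S: "subspace S" and v: "v \<in> S" and A: "A \<in> sets (subspace_lebesgue S)"
  shows "emeasure (subspace_lebesgue S) ((\<lambda>x. x + v) ` A) = emeasure (subspace_lebesgue S) A"
    and "(\<lambda>x. x + v) ` A \<in> sets (subspace_lebesgue S)"
proof -
  let ?R = "restrict_space borel S"
  have plus: "(\<lambda>x. x + (- v)) \<in> subspace_lebesgue S \<rightarrow>\<^sub>M ?R"
  proof (rule measurable_restrict_space2)
    show "(\<lambda>x. x + (- v)) \<in> space (subspace_lebesgue S) \<rightarrow> S"
      using S v by (auto simp: subspace_diff)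
    show "(\<lambda>x. x + (- v)) \<in> borel_measurable (subspace_lebesgue S)"
      unfolding measurable_cong_sets[OF sets_subspace_lebesgue[OF S] refl]
      by (rule measurable_restrict_space1) measurable
  qed
  have vi: "(\<lambda>x. x + (- v)) -` A \<inter> space (subspace_lebesgue S) = (\<lambda>x. x + v) ` A"
    using S v sets_subspace_lebesgue_borel[OF S A]
    by (auto simp: image_iff subspace_add intro!: bexI[of _ "_ - v"])
  have A': "A \<in> sets ?R" using A S by simp
  have "emeasure (subspace_lebesgue S) A
    = emeasure (distr (subspace_lebesgue S) ?R (\<lambda>x. x + (- v))) A"
    using subspace_lebesgue_translate[OF S, of "- v"] S v by (simp add: subspace_neg)
  also have "\<dots> = emeasure (subspace_lebesgue S) ((\<lambda>x. x + v) ` A)"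
    unfolding vi[symmetric] by (rule emeasure_distr[OF plus A'])
  finally show "emeasure (subspace_lebesgue S) ((\<lambda>x. x + v) ` A) = emeasure (subspace_lebesgue S) A" ..
  show "(\<lambda>x. x + v) ` A \<in> sets (subspace_lebesgue S)"
    using measurable_sets[OF plus A'] vi by simp
qed

text \<open>By Cauchy-Schwarz, orthonormal coordinates are bounded by the norm, so the coordinate
  preimage of a bounded set fits into a cube.\<close>

lemma emeasure_subspace_lebesgue_bounded:
  fixes S :: "'a::euclidean_space set"
  assumes S: "subspace S" and D: "D \<in> sets (subspace_lebesgue S)" "bounded D"
  shows "emeasure (subspace_lebesgue S) D < \<infinity>"
proof -
  obtain B where B: "finite B" "B \<subseteq> S" "pairwise orthogonal B" "\<And>b. b \<in> B \<Longrightarrow> norm b = 1" "span B = S"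
    and eq: "subspace_lebesgue S =
      distr (Pi\<^sub>M B (\<lambda>_. lborel)) (restrict_space borel S) (\<lambda>c. \<Sum>b\<in>B. c b *\<^sub>R b)"
    using subspace_lebesgue_orthonormal[OF S] by blast
  interpret product_sigma_finite "\<lambda>_ :: 'a. lborel :: real measure" by standard
  let ?P = "Pi\<^sub>M B (\<lambda>_. lborel) :: ('a \<Rightarrow> real) measure"
  let ?\<phi> = "\<lambda>c. \<Sum>b\<in>B. c b *\<^sub>R b"
  obtain r where r: "\<And>x. x \<in> D \<Longrightarrow> norm x \<le> r" using D(2) by (auto simp: bounded_iff)
  have D': "D \<in> sets (restrict_space borel S)" using D(1) S by simp
  have "emeasure (subspace_lebesgue S) D = emeasure ?P (?\<phi> -` D \<inter> space ?P)"
    unfolding eq by (intro emeasure_distr orthonormal_comb_measurable B S D')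
  also have "\<dots> \<le> emeasure ?P (Pi\<^sub>E B (\<lambda>_. {-r..r}))"
  proof (rule emeasure_mono)
    show "?\<phi> -` D \<inter> space ?P \<subseteq> Pi\<^sub>E B (\<lambda>_. {-r..r})"
    proof
      fix c assume c: "c \<in> ?\<phi> -` D \<inter> space ?P"
      have "\<bar>c b\<bar> \<le> r" if b: "b \<in> B" for b
      proof -
        have "\<bar>c b\<bar> = \<bar>?\<phi> c \<bullet> b\<bar>" by (subst orthonormal_inner_comb[OF B(1,3,4) b]) auto
        also have "\<dots> \<le> norm (?\<phi> c) * norm b" by (rule Cauchy_Schwarz_ineq2)
        also have "\<dots> \<le> r" using r c B(4)[OF b] by simp
        finally show ?thesis .
      qed
      then show "c \<in> Pi\<^sub>E B (\<lambda>_. {-r..r})" using c by (auto simp: space_PiM PiE_def abs_le_iff minus_le_iff)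
    qed
  qed (use B(1) in \<open>auto intro!: sets_PiM_I_finite\<close>)
  also have "\<dots> = (\<Prod>b\<in>B. emeasure lborel {-r..r})"
    by (rule emeasure_PiM[OF B(1)]) simp
  \<comment> \<open>If D is empty, r may be negative; the interval then has measure 0 and the
    product is a power of 0.\<close>
  also have "\<dots> < \<infinity>"
    by (auto simp: emeasure_lborel_Icc_eq ennreal_power power_0_left)
  finally show ?thesis .
qed

text \<open>This is what later forces fundamental domains to have positive volume. It covers the
  zero subspace too, where the empty product is 1.\<close>

lemma emeasure_subspace_lebesgue_space:
  fixes S :: "'a::euclidean_space set"
  assumes S: "subspace S"
  shows "emeasure (subspace_lebesgue S) S \<noteq> 0"
proof -
  obtain B where B: "finite B" "B \<subseteq> S" "pairwise orthogonal B" "\<And>b. b \<in> B \<Longrightarrow> norm b = 1" "span B = S"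
    and eq: "subspace_lebesgue S =
      distr (Pi\<^sub>M B (\<lambda>_. lborel)) (restrict_space borel S) (\<lambda>c. \<Sum>b\<in>B. c b *\<^sub>R b)"
    using subspace_lebesgue_orthonormal[OF S] by blast
  interpret product_sigma_finite "\<lambda>_ :: 'a. lborel :: real measure" by standard
  let ?P = "Pi\<^sub>M B (\<lambda>_. lborel) :: ('a \<Rightarrow> real) measure"
  let ?\<phi> = "\<lambda>c. \<Sum>b\<in>B. c b *\<^sub>R b"
  have \<phi>: "?\<phi> \<in> ?P \<rightarrow>\<^sub>M restrict_space borel S" by (rule orthonormal_comb_measurable[OF B(2) S])
  have "emeasure (subspace_lebesgue S) S = emeasure ?P (?\<phi> -` S \<inter> space ?P)"
    unfolding eq by (rule emeasure_distr[OF \<phi>])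
      (use S in_sets_subspace_lebesgue[OF S subset_refl] closed_subspace[OF S] in auto)
  also have "?\<phi> -` S \<inter> space ?P = Pi\<^sub>E B (\<lambda>_. UNIV)"
    using measurable_space[OF \<phi>] by (auto simp: space_PiM space_restrict_space)
  also have "emeasure ?P \<dots> = (\<Prod>b\<in>B. emeasure lborel (UNIV :: real set))"
    by (rule emeasure_PiM[OF B(1)]) simp
  also have "\<dots> \<noteq> 0" by simp
  finally show ?thesis .
qed

section \<open>Additive subgroups and their cosets\<close>

definition plus_subgroup :: "'a::ab_group_add set \<Rightarrow> bool" where
  "plus_subgroup A \<longleftrightarrow> 0 \<in> A \<and> (\<forall>x\<in>A. \<forall>y\<in>A. x - y \<in> A)"

lemma plus_subgroup_0: "plus_subgroup A \<Longrightarrow> 0 \<in> A"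
  and plus_subgroup_diff: "plus_subgroup A \<Longrightarrow> x \<in> A \<Longrightarrow> y \<in> A \<Longrightarrow> x - y \<in> A"
  by (simp_all add: plus_subgroup_def)

lemma plus_subgroup_neg: "plus_subgroup A \<Longrightarrow> x \<in> A \<Longrightarrow> - x \<in> A"
  using plus_subgroup_diff[of A 0 x] plus_subgroup_0[of A] by simp

lemma plus_subgroup_add: "plus_subgroup A \<Longrightarrow> x \<in> A \<Longrightarrow> y \<in> A \<Longrightarrow> x + y \<in> A"
  using plus_subgroup_diff[of A x "- y"] plus_subgroup_neg[of A y] by simp

text \<open>By \<open>r_coset_add_grp\<close> this is the group-theoretic coset in
  \<open>add_grp S\<close> for every S. Classes in \<open>Qhat_grp\<close> and in
  \<open>X_grp\<close> are therefore literally the same sets.\<close>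

definition acoset :: "'a::ab_group_add set \<Rightarrow> 'a \<Rightarrow> 'a set" where
  "acoset A x = (\<lambda>a. a + x) ` A"

lemma r_coset_add_grp [simp]: "A #>\<^bsub>add_grp S\<^esub> x = acoset A x"
  by (auto simp: r_coset_def add_grp_def acoset_def)

lemma carrier_add_grp_Mod: "carrier (add_grp S Mod A) = acoset A ` S"
  by (simp add: carrier_FactGroup) (simp add: add_grp_def)

lemma mem_acoset_iff: "y \<in> acoset A x \<longleftrightarrow> y - x \<in> A"
  by (auto simp: acoset_def image_iff intro!: bexI[of _ "y - x"])

lemma acoset_eq_iff:
  assumes "plus_subgroup A"
  shows "acoset A x = acoset A y \<longleftrightarrow> x - y \<in> A"
proof
  assume "acoset A x = acoset A y"
  then have "x \<in> acoset A y" using mem_acoset_iff[of x A x] plus_subgroup_0[OF assms] by simp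
  then show "x - y \<in> A" by (simp add: mem_acoset_iff)
next
  assume xy: "x - y \<in> A"
  show "acoset A x = acoset A y"
  proof (rule Set.set_eqI)
    fix z
    show "z \<in> acoset A x \<longleftrightarrow> z \<in> acoset A y"
      unfolding mem_acoset_iff
      using plus_subgroup_add[OF assms _ xy, of "z - x"] plus_subgroup_diff[OF assms _ xy, of "z - y"]
      by auto
  qed
qed

section \<open>Unitary characters of an inner product space\<close>

definition unit_char :: "'a::real_inner \<Rightarrow> 'a \<Rightarrow> complex" where
  "unit_char x y = exp (2 * of_real pi * \<i> * of_real (x \<bullet> y))"

lemma unit_char_add_left: "unit_char (x + x') y = unit_char x y * unit_char x' y"
  and unit_char_add_right: "unit_char x (y + y') = unit_char x y * unit_char x y'"
  by (simp_all add: unit_char_def inner_add_left inner_add_right algebra_simps exp_add flip: exp_add)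

lemma unit_char_0 [simp]: "unit_char x 0 = 1" "unit_char 0 y = 1"
  by (simp_all add: unit_char_def)

lemma unit_char_minus: "unit_char (- x) y = inverse (unit_char x y)" "unit_char x (- y) = inverse (unit_char x y)"
  by (simp_all add: unit_char_def exp_minus)

lemma norm_unit_char [simp]: "norm (unit_char x y) = 1"
proof -
  have "unit_char x y = cis (2 * pi * (x \<bullet> y))"
    by (simp add: unit_char_def cis_conv_exp algebra_simps)
  then show ?thesis by simp
qed

lemma unit_char_eq_1_iff: "unit_char x y = 1 \<longleftrightarrow> x \<bullet> y \<in> \<int>"
proof -
  have "unit_char x y = 1 \<longleftrightarrow> (\<exists>n::int. 2 * pi * (x \<bullet> y) = of_int (2 * n) * pi)"
    unfolding unit_char_def by (subst exp_eq_1) (simp add: algebra_simps)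
  also have "\<dots> \<longleftrightarrow> x \<bullet> y \<in> \<int>"
    by (auto simp: Ints_def)
  finally show ?thesis .
qed

lemma unit_char_cong:
  assumes "(x - x') \<bullet> y \<in> \<int>"
  shows "unit_char x y = unit_char x' y"
proof -
  have "unit_char (x' + (x - x')) y = unit_char x' y * unit_char (x - x') y"
    by (rule unit_char_add_left)
  then show ?thesis using assms unit_char_eq_1_iff[of "x - x'" y] by simp
qed

lemma continuous_on_unit_char [continuous_intros]: "continuous_on A (\<lambda>x. unit_char x y)"
  unfolding unit_char_def by (intro continuous_intros)

text \<open>A bounded Borel fundamental domain stands in for the usual condition that L is a
  discrete subgroup of full rank. Countability of L is what allows summation over the translates of
  a domain.\<close>

locale torus =
  fixes S L :: "'a::euclidean_space set"
  assumes S: "subspace S" and L_sub: "L \<subseteq> S" and L: "plus_subgroup L"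
    and L_countable: "countable L"
    and fd_ex: "\<exists>D. fundamental_domain S L D"
begin

abbreviation \<mu> :: "'a measure" where "\<mu> \<equiv> subspace_lebesgue S"
abbreviation q :: "'a \<Rightarrow> 'a set" where "q \<equiv> acoset L"
abbreviation X :: "'a set set" where "X \<equiv> carrier (add_grp S Mod L)"

definition T :: "'a set measure" where
  "T = sigma X {A. A \<subseteq> X \<and> \<Union>A \<in> sets borel}"

lemma L_0: "0 \<in> L"
  and L_diff: "x \<in> L \<Longrightarrow> y \<in> L \<Longrightarrow> x - y \<in> L"
  and L_neg: "x \<in> L \<Longrightarrow> - x \<in> L"
  using L by (simp_all add: plus_subgroup_0 plus_subgroup_diff plus_subgroup_neg)

lemmas X_eq = carrier_add_grp_Mod[of S L] and mem_q_iff = mem_acoset_iff[where A = L]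
  and q_eq_iff = acoset_eq_iff[OF L]

lemma q_subset: "x \<in> S \<Longrightarrow> q x \<subseteq> S"
  using S L_sub by (auto simp: acoset_def subspace_add)

lemma mem_Union_iff:
  assumes "A \<subseteq> X" "x \<in> S"
  shows "x \<in> \<Union>A \<longleftrightarrow> q x \<in> A"
proof
  assume "x \<in> \<Union>A"
  then obtain y where "x \<in> q y" "q y \<in> A" using assms X_eq by auto
  then show "q x \<in> A" using q_eq_iff mem_q_iff by metis
qed (use mem_q_iff[of x x] L_0 in auto)

lemma space_T [simp]: "space T = X"
  by (simp add: T_def space_measure_of_conv)

lemma Union_Borel_in_T: "A \<subseteq> X \<Longrightarrow> \<Union>A \<in> sets borel \<Longrightarrow> A \<in> sets T"
  unfolding T_def by (subst sets_measure_of) auto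

lemma q_measurable: "q \<in> \<mu> \<rightarrow>\<^sub>M T"
  unfolding T_def
proof (rule measurable_measure_of)
  fix A assume "A \<in> {A. A \<subseteq> X \<and> \<Union>A \<in> sets borel}"
  then have A: "A \<subseteq> X" "\<Union>A \<in> sets borel" by auto
  have "\<Union>A \<subseteq> S" using A(1) q_subset unfolding X_eq by blast
  then have "q -` A \<inter> space \<mu> = \<Union>A" using mem_Union_iff[OF A(1)] S by auto
  then show "q -` A \<inter> space \<mu> \<in> sets \<mu>"
    using A(2) \<open>\<Union>A \<subseteq> S\<close> in_sets_subspace_lebesgue[OF S] by simp
qed (use X_eq S in auto)

lemma fd_sets:
  assumes "fundamental_domain S L D"
  shows "D \<in> sets \<mu>" "D \<subseteq> S"
  using assms in_sets_subspace_lebesgue[OF S, of D] by (auto simp: fundamental_domain_def)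

lemma fd_unique:
  assumes "fundamental_domain S L D" "d \<in> D" "d' \<in> D" "d - d' \<in> L"
  shows "d = d'"
proof -
  have "d \<in> S" using assms(2) fd_sets(2)[OF assms(1)] by blast
  then have "\<exists>!x. x \<in> D \<and> d - x \<in> L" using assms(1) unfolding fundamental_domain_def by blast
  then show ?thesis using assms L_0 by (metis diff_self)
qed

lemma fd_translates_disjoint:
  assumes "fundamental_domain S L D"
  shows "disjoint_family_on (\<lambda>l. A \<inter> (\<lambda>x. x + l) ` D) L"
  unfolding disjoint_family_on_def
proof (intro ballI impI, rule ccontr)
  fix l m assume lm: "l \<in> L" "m \<in> L" "l \<noteq> m" "A \<inter> (\<lambda>x. x + l) ` D \<inter> (A \<inter> (\<lambda>x. x + m) ` D) \<noteq> {}"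
  then obtain d d' where d: "d \<in> D" "d' \<in> D" "d + l = d' + m" by auto
  then have "d - d' = m - l" by (simp add: algebra_simps)
  then have "d = d'" using fd_unique[OF assms d(1,2)] L_diff lm by simp
  then show False using d(3) lm(3) by simp
qed

lemma fd_translates_cover:
  assumes "fundamental_domain S L D" "A \<subseteq> S"
  shows "(\<Union>l\<in>L. A \<inter> (\<lambda>x. x + l) ` D) = A"
proof (intro equalityI subsetI)
  fix x assume x: "x \<in> A"
  then obtain d where d: "d \<in> D" "x - d \<in> L" using assms unfolding fundamental_domain_def by blast
  have "x = d + (x - d)" by simp
  then show "x \<in> (\<Union>l\<in>L. A \<inter> (\<lambda>x. x + l) ` D)" using x d by blast
qed auto

text \<open>The translates of D by L tile S, by existence and uniqueness of representatives, and
  countable additivity sums the pieces.\<close>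

lemma fd_emeasure_decomp:
  assumes D: "fundamental_domain S L D" and A: "A \<in> sets \<mu>"
  shows "emeasure \<mu> A = (\<integral>\<^sup>+ l. emeasure \<mu> (A \<inter> (\<lambda>x. x + l) ` D) \<partial>count_space L)"
proof -
  have "emeasure \<mu> (\<Union>l\<in>L. A \<inter> (\<lambda>x. x + l) ` D) = (\<integral>\<^sup>+ l. emeasure \<mu> (A \<inter> (\<lambda>x. x + l) ` D) \<partial>count_space L)"
    by (intro emeasure_UN_countable fd_translates_disjoint[OF D] L_countable sets.Int A
        emeasure_subspace_lebesgue_translate(2)[OF S]) (use L_sub fd_sets[OF D] in auto)
  then show ?thesis
    using fd_translates_cover[OF D, of A] sets_subspace_lebesgue_borel[OF S A] by simp
qed

text \<open>The part of \<open>A \<inter> D\<close> lying in \<open>D' + l\<close> is moved by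
  \<open>-l\<close> onto the part of \<open>A \<inter> D'\<close> lying in \<open>D - l\<close>; A
  is preserved because it is periodic. Summing over l and replacing l by \<open>-l\<close>
  reassembles \<open>A \<inter> D'\<close>.\<close>

lemma fd_emeasure_eq:
  assumes D: "fundamental_domain S L D" and D': "fundamental_domain S L D'" and A: "A \<in> sets \<mu>"
    and per: "\<And>x l. x \<in> S \<Longrightarrow> l \<in> L \<Longrightarrow> x + l \<in> A \<longleftrightarrow> x \<in> A"
  shows "emeasure \<mu> (A \<inter> D) = emeasure \<mu> (A \<inter> D')"
proof -
  have eq: "emeasure \<mu> (A \<inter> D \<inter> (\<lambda>x. x + l) ` D') = emeasure \<mu> (A \<inter> D' \<inter> (\<lambda>x. x + - l) ` D)"
    if l: "l \<in> L" for l
  proof -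
    have lS: "- l \<in> S" using l L_neg L_sub by blast
    have sets: "A \<inter> D' \<inter> (\<lambda>x. x + - l) ` D \<in> sets \<mu>"
      by (intro sets.Int A fd_sets[OF D'] emeasure_subspace_lebesgue_translate(2)[OF S lS] fd_sets[OF D])
    have "A \<inter> D \<inter> (\<lambda>x. x + l) ` D' = (\<lambda>x. x + l) ` (A \<inter> D' \<inter> (\<lambda>x. x + - l) ` D)"
    proof (intro equalityI subsetI)
      fix x assume "x \<in> A \<inter> D \<inter> (\<lambda>x. x + l) ` D'"
      then obtain y where y: "y \<in> D'" "x = y + l" "x \<in> A" "x \<in> D" by auto
      then have "y \<in> A" using per[OF _ l, of y] fd_sets(2)[OF D'] by auto
      moreover have "y = x + - l" using y(2) by simp
      ultimately show "x \<in> (\<lambda>x. x + l) ` (A \<inter> D' \<inter> (\<lambda>x. x + - l) ` D)" using y by blast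
    next
      fix x assume "x \<in> (\<lambda>x. x + l) ` (A \<inter> D' \<inter> (\<lambda>x. x + - l) ` D)"
      then obtain y d where y: "x = y + l" "y \<in> A" "y \<in> D'" "d \<in> D" "y = d + - l" by auto
      then have "x \<in> A" "x = d" using per[OF _ l, of y] fd_sets(2)[OF D'] by auto
      then show "x \<in> A \<inter> D \<inter> (\<lambda>x. x + l) ` D'" using y by blast
    qed
    then show ?thesis
      using emeasure_subspace_lebesgue_translate(1)[OF S _ sets, of l] l L_sub by auto
  qed
  have "emeasure \<mu> (A \<inter> D) = (\<integral>\<^sup>+ l. emeasure \<mu> (A \<inter> D \<inter> (\<lambda>x. x + l) ` D') \<partial>count_space L)"
    by (intro fd_emeasure_decomp[OF D'] sets.Int A fd_sets[OF D])
  also have "\<dots> = (\<integral>\<^sup>+ l. emeasure \<mu> (A \<inter> D' \<inter> (\<lambda>x. x + - l) ` D) \<partial>count_space L)"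
    by (intro nn_integral_cong) (simp add: eq)
  also have "\<dots> = (\<integral>\<^sup>+ l. emeasure \<mu> (A \<inter> D' \<inter> (\<lambda>x. x + l) ` D) \<partial>count_space L)"
  proof (rule nn_integral_bij_count_space)
    show "bij_betw uminus L L"
      by (rule bij_betwI[of _ _ _ uminus]) (auto intro: L_neg)
  qed
  also have "\<dots> = emeasure \<mu> (A \<inter> D')"
    by (intro fd_emeasure_decomp[OF D, symmetric] sets.Int A fd_sets[OF D'])
  finally show ?thesis .
qed

text \<open>If D were null, the whole subspace would be a countable union of null
  translates.\<close>

lemma fd_emeasure_pos:
  assumes D: "fundamental_domain S L D"
  shows "emeasure \<mu> D > 0"
proof (rule ccontr)
  assume "\<not> emeasure \<mu> D > 0"
  then have 0: "emeasure \<mu> D = 0" by (simp add: not_gr_zero)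
  have "S \<in> sets \<mu>" using in_sets_subspace_lebesgue[OF S] closed_subspace[OF S] by simp
  note fd_emeasure_decomp[OF D this]
  also have "(\<integral>\<^sup>+ l. emeasure \<mu> (S \<inter> (\<lambda>x. x + l) ` D) \<partial>count_space L) = (\<integral>\<^sup>+ l. 0 \<partial>count_space L)"
  proof (rule nn_integral_cong)
    fix l assume "l \<in> space (count_space L)"
    then have l: "l \<in> S" using L_sub by auto
    have "emeasure \<mu> (S \<inter> (\<lambda>x. x + l) ` D) \<le> emeasure \<mu> ((\<lambda>x. x + l) ` D)"
      by (intro emeasure_mono emeasure_subspace_lebesgue_translate(2)[OF S l] fd_sets[OF D]) auto
    also have "\<dots> = 0" using 0 emeasure_subspace_lebesgue_translate(1)[OF S l fd_sets(1)[OF D]] by simp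
    finally show "emeasure \<mu> (S \<inter> (\<lambda>x. x + l) ` D) = 0" by simp
  qed
  finally show False using emeasure_subspace_lebesgue_space[OF S] by simp
qed

lemma fd_translate:
  assumes D: "fundamental_domain S L D" and v: "v \<in> S"
  shows "fundamental_domain S L ((\<lambda>x. x + v) ` D)"
  unfolding fundamental_domain_def
proof (intro conjI ballI)
  have s: "(\<lambda>x. x + v) ` D \<in> sets \<mu>"
    by (rule emeasure_subspace_lebesgue_translate(2)[OF S v fd_sets(1)[OF D]])
  then show "(\<lambda>x. x + v) ` D \<subseteq> S" "(\<lambda>x. x + v) ` D \<in> sets borel"
    using sets_subspace_lebesgue_borel[OF S] by auto
  have "(\<lambda>x. x + v) ` D = (+) v ` D" by (auto simp: add.commute)
  then show "bounded ((\<lambda>x. x + v) ` D)"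
    using D bounded_translation[of D v] by (auto simp: fundamental_domain_def)
  fix x assume "x \<in> S"
  then have "x - v \<in> S" using S v by (simp add: subspace_diff)
  then obtain d where d: "d \<in> D" "x - v - d \<in> L" using D unfolding fundamental_domain_def by blast
  show "\<exists>!d. d \<in> (\<lambda>x. x + v) ` D \<and> x - d \<in> L"
  proof (rule ex1I[of _ "d + v"])
    show "d + v \<in> (\<lambda>x. x + v) ` D \<and> x - (d + v) \<in> L" using d by (auto simp: algebra_simps)
    fix e assume e: "e \<in> (\<lambda>x. x + v) ` D \<and> x - e \<in> L"
    then obtain d' where d': "d' \<in> D" "e = d' + v" by auto
    have "(x - v - d) - (x - e) \<in> L" using d e L_diff by blast
    then have "d' - d \<in> L" using d' by (simp add: algebra_simps)
    then show "e = d + v" using fd_unique[OF D d'(1) d(1)] d' by simp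
  qed
qed

text \<open>The preimage of a set of cosets under \<open>q\<close> is periodic under L, so any two
  domains meet it in the same measure. With this, the choice inside \<open>torus_measure\<close>
  becomes harmless.\<close>

lemma distr_fd_eq:
  assumes D: "fundamental_domain S L D" and D': "fundamental_domain S L D'"
  shows "distr (restrict_space \<mu> D) T q = distr (restrict_space \<mu> D') T q"
proof (rule measure_eqI)
  fix A assume "A \<in> sets (distr (restrict_space \<mu> D) T q)"
  then have A: "A \<in> sets T" by simp
  have qA: "q -` A \<inter> S \<in> sets \<mu>" using measurable_sets[OF q_measurable A] S by simp
  have *: "emeasure (distr (restrict_space \<mu> D) T q) A = emeasure \<mu> ((q -` A \<inter> S) \<inter> D)"
    if D: "fundamental_domain S L D" for D
  proof -
    have "emeasure (distr (restrict_space \<mu> D) T q) A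
        = emeasure (restrict_space \<mu> D) (q -` A \<inter> space (restrict_space \<mu> D))"
      by (rule emeasure_distr[OF measurable_restrict_space1[OF q_measurable] A])
    also have "q -` A \<inter> space (restrict_space \<mu> D) = (q -` A \<inter> S) \<inter> D"
      using S by (auto simp: space_restrict_space)
    also have "emeasure (restrict_space \<mu> D) \<dots> = emeasure \<mu> \<dots>"
      by (rule emeasure_restrict_space) (use fd_sets[OF D] S in \<open>auto simp: Int_absorb2\<close>)
    finally show ?thesis .
  qed
  show "emeasure (distr (restrict_space \<mu> D) T q) A = emeasure (distr (restrict_space \<mu> D') T q) A"
    unfolding *[OF D] *[OF D']
  proof (rule fd_emeasure_eq[OF D D' qA])
    fix x l assume "x \<in> S" "l \<in> L"
    then show "x + l \<in> q -` A \<inter> S \<longleftrightarrow> x \<in> q -` A \<inter> S"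
      using q_eq_iff[of "x + l" x] S L_sub by (auto simp: subspace_add)
  qed
qed simp

lemma torus_measure_eq:
  assumes D: "fundamental_domain S L D"
  shows "torus_measure S L = distr (restrict_space \<mu> D) T q"
proof -
  have "torus_measure S L = distr (restrict_space \<mu> (SOME D. fundamental_domain S L D)) T q"
    by (simp add: torus_measure_def Let_def T_def)
  also have "\<dots> = distr (restrict_space \<mu> D) T q"
    by (rule distr_fd_eq[OF someI_ex[OF fd_ex] D])
  finally show ?thesis .
qed

lemma measure_torus:
  assumes D: "fundamental_domain S L D"
  shows "measure (torus_measure S L) X = measure \<mu> D" "measure \<mu> D > 0"
proof -
  have "measure (torus_measure S L) X = measure (restrict_space \<mu> D) (q -` X \<inter> space (restrict_space \<mu> D))"
    unfolding torus_measure_eq[OF D]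
    by (rule measure_distr[OF measurable_restrict_space1[OF q_measurable]]) (metis sets.top space_T)
  also have "q -` X \<inter> space (restrict_space \<mu> D) = D"
    using S fd_sets(2)[OF D] X_eq by (auto simp: space_restrict_space)
  also have "measure (restrict_space \<mu> D) D = measure \<mu> D"
    by (rule measure_restrict_space) (use fd_sets[OF D] S in \<open>auto simp: Int_absorb2\<close>)
  finally show "measure (torus_measure S L) X = measure \<mu> D" .
  \<comment> \<open>\<open>measure\<close> sends an infinite value to 0, so positivity also requires
    finite volume, which boundedness of D provides.\<close>
  have "emeasure \<mu> D < \<infinity>"
    using emeasure_subspace_lebesgue_bounded[OF S fd_sets(1)[OF D]] D by (auto simp: fundamental_domain_def)
  then show "measure \<mu> D > 0"
    using fd_emeasure_pos[OF D] by (auto simp: measure_def enn2real_positive_iff)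
qed

text \<open>A set of cosets is tested for measurability through its union, and the union of a
  preimage under g is the corresponding preimage under the continuous lift f.\<close>

lemma continuous_class_function_measurable:
  fixes f :: "'a \<Rightarrow> complex"
  assumes f: "continuous_on S f" and g: "\<And>y. y \<in> S \<Longrightarrow> g (q y) = f y"
  shows "g \<in> borel_measurable T"
proof (rule measurableI)
  fix A :: "complex set" assume A: "A \<in> sets borel"
  have "f \<in> borel_measurable (restrict_space borel S)"
    using f by (rule borel_measurable_continuous_on_restrict)
  then have "f -` A \<inter> space \<mu> \<in> sets \<mu>"
    using A S by (metis measurable_cong_sets measurable_sets sets_subspace_lebesgue)
  then have "f -` A \<inter> S \<in> sets borel" using sets_subspace_lebesgue_borel[OF S] S by simp
  also have "f -` A \<inter> S = \<Union>(g -` A \<inter> X)"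
  proof -
    have "\<Union>(g -` A \<inter> X) \<subseteq> S" using q_subset unfolding X_eq by blast
    moreover have "x \<in> \<Union>(g -` A \<inter> X) \<longleftrightarrow> x \<in> f -` A" if "x \<in> S" for x
      using mem_Union_iff[of "g -` A \<inter> X" x] that g X_eq by auto
    ultimately show ?thesis by blast
  qed
  finally show "g -` A \<inter> space T \<in> sets T" by (intro Union_Borel_in_T) auto
qed simp

lemma integral_torus:
  fixes f :: "'a \<Rightarrow> complex"
  assumes D: "fundamental_domain S L D"
    and f: "continuous_on S f" and g: "\<And>y. y \<in> S \<Longrightarrow> g (q y) = f y"
  shows "(LINT x|torus_measure S L. g x) = (LINT y|\<mu>. indicator D y *\<^sub>R f y)"
proof -
  have "(LINT x|torus_measure S L. g x) = (LINT y|restrict_space \<mu> D. g (q y))"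
    unfolding torus_measure_eq[OF D]
    by (rule integral_distr[OF measurable_restrict_space1[OF q_measurable]
          continuous_class_function_measurable[OF f g]])
  also have "\<dots> = (LINT y|restrict_space \<mu> D. f y)"
    using g fd_sets(2)[OF D] S by (intro Bochner_Integration.integral_cong) (auto simp: space_restrict_space)
  also have "\<dots> = (LINT y|\<mu>. indicator D y *\<^sub>R f y)"
    by (rule integral_restrict_space) (use fd_sets[OF D] S in \<open>auto simp: Int_absorb2\<close>)
  finally show ?thesis .
qed

text \<open>
  Translating the domain of integration by \<open>v\<close> leaves the integral of a class function unchanged,
  and multiplies that of the character by its value at \<open>v\<close>.
\<close>
lemma integral_unit_char:
  assumes D: "fundamental_domain S L D"
    and \<beta>: "\<beta> \<in> S" "\<beta> \<noteq> 0" "\<And>l. l \<in> L \<Longrightarrow> l \<bullet> \<beta> \<in> \<int>"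
  shows "(LINT y|\<mu>. indicator D y *\<^sub>R unit_char y \<beta>) = 0"
proof -
  \<comment> \<open>The scaling gives \<open>v \<bullet> \<beta> = 1 / 2\<close>, so the character
    takes the value -1 at v.\<close>
  define v where "v = (1 / (2 * (\<beta> \<bullet> \<beta>))) *\<^sub>R \<beta>"
  have v: "v \<in> S" unfolding v_def using S \<beta>(1) by (rule subspace_scale)
  have "v \<bullet> \<beta> = 1 / 2" using \<beta>(2) by (simp add: v_def)
  moreover have "(1 / 2 :: real) \<notin> \<int>" using Ints_nonzero_abs_less1[of "1 / 2 :: real"] by auto
  ultimately have nv: "unit_char v \<beta> \<noteq> 1" by (simp only: unit_char_eq_1_iff not_False_eq_True)
  \<comment> \<open>The character descends to cosets because \<beta> is integral on L, so an
    arbitrary representative may be used.\<close>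
  define g where "g A = unit_char (SOME y. y \<in> S \<and> q y = A) \<beta>" for A
  have g: "g (q y) = unit_char y \<beta>" if "y \<in> S" for y
  proof -
    have "(SOME z. z \<in> S \<and> q z = q y) \<in> S \<and> q (SOME z. z \<in> S \<and> q z = q y) = q y"
      by (rule someI_ex) (use that in blast)
    then show ?thesis unfolding g_def using \<beta>(3) by (intro unit_char_cong) (auto simp: q_eq_iff)
  qed
  note int = integral_torus[OF _ continuous_on_unit_char g]
  \<comment> \<open>Both sides equal the torus integral of g, computed on D and on its
    translate.\<close>
  have "(LINT y|\<mu>. indicator D y *\<^sub>R unit_char y \<beta>)
      = (LINT y|\<mu>. indicator ((\<lambda>x. x + v) ` D) y *\<^sub>R unit_char y \<beta>)"
    using int[OF D] int[OF fd_translate[OF D v]] by simp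
  also have "\<dots> = (LINT y|distr \<mu> (restrict_space borel S) (\<lambda>x. x + v). indicator ((\<lambda>x. x + v) ` D) y *\<^sub>R unit_char y \<beta>)"
    by (simp only: subspace_lebesgue_translate[OF S v])
  also have "\<dots> = (LINT y|\<mu>. indicator ((\<lambda>x. x + v) ` D) (y + v) *\<^sub>R unit_char (y + v) \<beta>)"
  proof (rule integral_distr)
    show "(\<lambda>x. x + v) \<in> \<mu> \<rightarrow>\<^sub>M restrict_space borel S"
    proof (rule measurable_restrict_space2)
      show "(\<lambda>x. x + v) \<in> space \<mu> \<rightarrow> S" using S v by (auto simp: subspace_add)
      show "(\<lambda>x. x + v) \<in> borel_measurable \<mu>"
        unfolding measurable_cong_sets[OF sets_subspace_lebesgue[OF S] refl]
        by (rule measurable_restrict_space1) measurable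
    qed
    have "(\<lambda>x. x + v) ` D \<in> sets borel"
      using fd_translate[OF D v] by (auto simp: fundamental_domain_def)
    then show "(\<lambda>y. indicator ((\<lambda>x. x + v) ` D) y *\<^sub>R unit_char y \<beta>)
        \<in> borel_measurable (restrict_space borel S)"
      by (intro measurable_restrict_space1 borel_measurable_scaleR borel_measurable_indicator
          borel_measurable_continuous_onI continuous_on_unit_char)
  qed
  also have "\<dots> = (LINT y|\<mu>. unit_char v \<beta> * (indicator D y *\<^sub>R unit_char y \<beta>))"
    by (intro Bochner_Integration.integral_cong) (auto simp: unit_char_add_left indicator_def)
  also have "\<dots> = unit_char v \<beta> * (LINT y|\<mu>. indicator D y *\<^sub>R unit_char y \<beta>)"
    by (rule integral_mult_right_zero)
  finally show ?thesis using nv by simp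
qed

text \<open>Orthogonality in the form needed for inversion: the index set will be the circuits of a
  given length and \<open>\<beta> as\<close> will be \<open>Cab as - \<alpha>\<close>, so the
  cardinality is the desired circuit count. Positive volume permits the final division.\<close>

theorem integral_torus_unit_char_sum:
  assumes "finite I" and \<beta>: "\<And>i. i \<in> I \<Longrightarrow> \<beta> i \<in> S" "\<And>i l. i \<in> I \<Longrightarrow> l \<in> L \<Longrightarrow> l \<bullet> \<beta> i \<in> \<int>"
    and g: "\<And>y. y \<in> S \<Longrightarrow> g (q y) = (\<Sum>i\<in>I. unit_char y (\<beta> i))"
  shows "(LINT x|torus_measure S L. g x)
      = of_nat (card {i \<in> I. \<beta> i = 0}) * of_real (measure (torus_measure S L) X)"
    and "measure (torus_measure S L) X > 0"
proof -
  obtain D where D: "fundamental_domain S L D" using fd_ex by blast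
  show "measure (torus_measure S L) X > 0" using measure_torus[OF D] by simp
  have fin: "emeasure \<mu> D < \<infinity>"
    using emeasure_subspace_lebesgue_bounded[OF S fd_sets(1)[OF D]] D by (auto simp: fundamental_domain_def)
  have int: "integrable \<mu> (\<lambda>y. indicator D y *\<^sub>R unit_char y b)" for b
  proof (rule integrableI_bounded_set[of D _ _ 1])
    have "(\<lambda>y. indicator D y *\<^sub>R unit_char y b) \<in> borel_measurable borel"
      using D by (intro borel_measurable_scaleR borel_measurable_indicator
          borel_measurable_continuous_onI continuous_on_unit_char) (auto simp: fundamental_domain_def)
    then show "(\<lambda>y. indicator D y *\<^sub>R unit_char y b) \<in> borel_measurable \<mu>"
      unfolding measurable_cong_sets[OF sets_subspace_lebesgue[OF S] refl]
      by (rule measurable_restrict_space1)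
  qed (use fin fd_sets[OF D] in auto)
  have one: "(LINT y|\<mu>. indicator D y *\<^sub>R unit_char y (\<beta> i)) = (if \<beta> i = 0 then of_real (measure \<mu> D) else 0)"
    if "i \<in> I" for i
  proof (cases "\<beta> i = 0")
    case True
    have "(LINT y|\<mu>. indicator D y *\<^sub>R unit_char y (\<beta> i)) = (LINT y|\<mu>. of_real (indicator D y))"
      using True by (intro Bochner_Integration.integral_cong) (auto simp: indicator_def)
    also have "\<dots> = of_real (measure \<mu> D)"
      using fd_sets[OF D] S by (simp add: integral_complex_of_real Int_absorb2)
    finally show ?thesis using True by simp
  qed (use integral_unit_char[OF D \<beta>(1)] \<beta>(2) that in auto)
  have "(LINT x|torus_measure S L. g x) = (LINT y|\<mu>. indicator D y *\<^sub>R (\<Sum>i\<in>I. unit_char y (\<beta> i)))"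
    by (rule integral_torus[OF D]) (intro continuous_intros, rule g)
  also have "\<dots> = (\<Sum>i\<in>I. LINT y|\<mu>. indicator D y *\<^sub>R unit_char y (\<beta> i))"
    unfolding scaleR_sum_right by (rule Bochner_Integration.integral_sum) (rule int)
  also have "\<dots> = (\<Sum>i\<in>I. if \<beta> i = 0 then of_real (measure \<mu> D) else 0)"
    by (rule sum.cong[OF refl one])
  also have "\<dots> = of_nat (card {i \<in> I. \<beta> i = 0}) * of_real (measure \<mu> D)"
    using assms(1) by (simp add: sum.If_cases Int_def)
  finally show "(LINT x|torus_measure S L. g x)
      = of_nat (card {i \<in> I. \<beta> i = 0}) * of_real (measure (torus_measure S L) X)"
    by (simp add: measure_torus(1)[OF D])
qed

end

section \<open>Dual lattices\<close>

text \<open>The vector dual to b is the component of b orthogonal to the other members of B,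
  rescaled to have inner product 1 with b. Independence makes that component nonzero.\<close>

lemma independent_dual_basis:
  fixes B :: "'a::euclidean_space set"
  assumes "independent B"
  obtains d where "\<And>b. b \<in> B \<Longrightarrow> d b \<in> span B"
    "\<And>b b'. b \<in> B \<Longrightarrow> b' \<in> B \<Longrightarrow> d b \<bullet> b' = (if b' = b then 1 else 0)"
proof -
  have "\<exists>d. d \<in> span B \<and> (\<forall>b'\<in>B. d \<bullet> b' = (if b' = b then 1 else 0))" if b: "b \<in> B" for b
  proof -
    obtain y z where yz: "y \<in> span (B - {b})" "\<And>w. w \<in> span (B - {b}) \<Longrightarrow> orthogonal z w" "b = y + z"
      by (metis orthogonal_subspace_decomp_exists)
    have "b \<notin> span (B - {b})" using assms b by (auto simp: dependent_def)
    then have z: "z \<noteq> 0" using yz by auto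
    have "z \<bullet> y = 0" using yz by (auto simp: orthogonal_def)
    then have zb: "z \<bullet> b = z \<bullet> z" using yz(3) by (simp add: inner_add_right)
    have "y \<in> span B" using yz(1) span_mono[of "B - {b}" B] by auto
    then have zS: "z \<in> span B" using yz(3) span_diff[OF span_base[OF b], of y] by simp
    show ?thesis
    proof (intro exI[of _ "(1 / (z \<bullet> z)) *\<^sub>R z"] conjI ballI)
      fix b' assume "b' \<in> B"
      then show "(1 / (z \<bullet> z)) *\<^sub>R z \<bullet> b' = (if b' = b then 1 else 0)"
        using z zb yz(2)[of b'] by (auto simp: orthogonal_def span_base)
    qed (use zS span_scale in blast)
  qed
  then show ?thesis using that by metis
qed

lemma inner_span_eq_0:
  fixes x :: "'a::real_inner"
  assumes "x \<in> span B" "\<And>b. b \<in> B \<Longrightarrow> x \<bullet> b = 0"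
  shows "x = 0"
proof -
  have "orthogonal x y" if "y \<in> span B" for y
    using that by (rule orthogonal_to_span) (use assms(2) in \<open>auto simp: orthogonal_def\<close>)
  then show ?thesis using assms(1) by (metis orthogonal_self)
qed

lemma inner_int_comb_Ints:
  assumes "\<And>b. b \<in> B \<Longrightarrow> x \<bullet> b \<in> \<int>" "\<alpha> \<in> int_comb B"
  shows "x \<bullet> \<alpha> \<in> \<int>"
  using assms by (auto simp: int_comb_def inner_sum_right intro!: Ints_sum Ints_mult)

text \<open>The coordinate of \<alpha> at b is its inner product with the dual vector
  \<open>d b\<close>. That vector is integral on B, so the last assumption makes the coordinate an
  integer.\<close>

lemma int_comb_double_dual:
  fixes B :: "'a::euclidean_space set"
  assumes B: "finite B" "independent B" and \<alpha>: "\<alpha> \<in> span B"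
    and int: "\<And>x. x \<in> span B \<Longrightarrow> (\<And>b. b \<in> B \<Longrightarrow> x \<bullet> b \<in> \<int>) \<Longrightarrow> x \<bullet> \<alpha> \<in> \<int>"
  shows "\<alpha> \<in> int_comb B"
proof -
  obtain d where d: "\<And>b. b \<in> B \<Longrightarrow> d b \<in> span B"
    "\<And>b b'. b \<in> B \<Longrightarrow> b' \<in> B \<Longrightarrow> d b \<bullet> b' = (if b' = b then 1 else 0)"
    using independent_dual_basis[OF B(2)] by metis
  obtain c where c: "\<alpha> = (\<Sum>b\<in>B. c b *\<^sub>R b)" using \<alpha> span_finite[OF B(1)] by auto
  have "c b \<in> \<int>" if b: "b \<in> B" for b
  proof -
    have "d b \<bullet> \<alpha> \<in> \<int>" by (rule int[OF d(1)[OF b]]) (use d(2)[OF b] in auto)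
    also have "d b \<bullet> \<alpha> = (\<Sum>b'\<in>B. if b' = b then c b else 0)"
      unfolding c inner_sum_right using d(2)[OF b] by (intro sum.cong) auto
    finally show ?thesis using B(1) b by simp
  qed
  then have "\<alpha> = (\<Sum>b\<in>B. of_int \<lfloor>c b\<rfloor> *\<^sub>R b)" unfolding c by (intro sum.cong) auto
  then show ?thesis unfolding int_comb_def
    by (intro CollectI exI[of _ "\<lambda>b. \<lfloor>c b\<rfloor>"] conjI TrueI)
qed

text \<open>In the coordinates \<open>x \<bullet> b\<close>, the dual lattice becomes the integer
  lattice, and the half-open unit cube is a fundamental domain.\<close>

lemma torus_dual_lattice:
  fixes B :: "'a::euclidean_space set"
  assumes B: "finite B" "independent B"
  shows "torus (span B) {x \<in> span B. \<forall>b\<in>B. x \<bullet> b \<in> \<int>}"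
proof -
  let ?S = "span B" and ?L = "{x \<in> span B. \<forall>b\<in>B. x \<bullet> b \<in> \<int>}"
  obtain d where d: "\<And>b. b \<in> B \<Longrightarrow> d b \<in> span B"
    "\<And>b b'. b \<in> B \<Longrightarrow> b' \<in> B \<Longrightarrow> d b \<bullet> b' = (if b' = b then 1 else 0)"
    using independent_dual_basis[OF B(2)] by metis
  have comb: "(\<Sum>b\<in>B. c b *\<^sub>R d b) \<bullet> b' = c b'" if b': "b' \<in> B" for c b'
  proof -
    have "(\<Sum>b\<in>B. c b *\<^sub>R d b) \<bullet> b' = (\<Sum>b\<in>B. if b = b' then c b' else 0)"
      unfolding inner_sum_left using d(2)[OF _ b'] by (intro sum.cong) auto
    then show ?thesis using B(1) b' by simp
  qed
  have comb_span: "(\<Sum>b\<in>B. c b *\<^sub>R d b) \<in> ?S" for c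
    by (intro span_sum span_scale d(1))
  have expand: "x = (\<Sum>b\<in>B. (x \<bullet> b) *\<^sub>R d b)" if "x \<in> ?S" for x
  proof -
    have "x - (\<Sum>b\<in>B. (x \<bullet> b) *\<^sub>R d b) = 0"
      by (rule inner_span_eq_0[of _ B]) (use comb comb_span that in \<open>auto simp: inner_diff_left intro!: span_diff\<close>)
    then show ?thesis by simp
  qed
  let ?D = "{x \<in> ?S. \<forall>b\<in>B. 0 \<le> x \<bullet> b \<and> x \<bullet> b < 1}"
  have "fundamental_domain ?S ?L ?D"
    unfolding fundamental_domain_def
  proof (intro conjI ballI)
    show "bounded ?D"
      unfolding bounded_iff
    proof (intro exI ballI)
      fix x assume x: "x \<in> ?D"
      have "norm x = norm (\<Sum>b\<in>B. (x \<bullet> b) *\<^sub>R d b)" using expand x by auto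
      also have "\<dots> \<le> (\<Sum>b\<in>B. \<bar>x \<bullet> b\<bar> * norm (d b))" by (rule sum_norm_le) simp
      also have "\<dots> \<le> (\<Sum>b\<in>B. norm (d b))"
        using x by (intro sum_mono mult_left_le_one_le) auto
      finally show "norm x \<le> (\<Sum>b\<in>B. norm (d b))" .
    qed
    have "?D = ?S \<inter> (\<Inter>b\<in>B. {x. 0 \<le> x \<bullet> b} \<inter> {x. x \<bullet> b < 1})" by auto
    \<comment> \<open>The half-spaces are put into the form over \<open>space borel\<close> that the
      \<open>measurable\<close> method can handle.\<close>
    also have "\<dots> = ?S \<inter> (\<Inter>b\<in>B. {x \<in> space borel. 0 \<le> x \<bullet> b} \<inter> {x \<in> space borel. x \<bullet> b < 1})" by simp
    also have "\<dots> \<in> sets borel"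
    \<comment> \<open>\<open>sets.finite_INT\<close> requires a nonempty index set.\<close>
    proof (cases "B = {}")
      case False
      have "?S \<in> sets borel" by (simp add: closed_subspace subspace_span borel_closed)
      moreover have "(\<Inter>b\<in>B. {x \<in> space borel. 0 \<le> x \<bullet> b} \<inter> {x \<in> space borel. x \<bullet> b < 1}) \<in> sets borel"
        by (rule sets.finite_INT[OF B(1) False]) measurable
      ultimately show ?thesis by blast
    qed simp
    finally show "?D \<in> sets borel" .
    fix x assume x: "x \<in> ?S"
    \<comment> \<open>Reducing every coordinate modulo 1 moves x into the half-open cube along the
      dual lattice.\<close>
    define y where "y = (\<Sum>b\<in>B. frac (x \<bullet> b) *\<^sub>R d b)"
    have y: "y \<in> ?S" "y \<bullet> b = frac (x \<bullet> b)" if "b \<in> B" for b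
      using comb_span comb[OF that] by (auto simp: y_def)
    have yS: "y \<in> ?S" unfolding y_def by (rule comb_span)
    show "\<exists>!y. y \<in> ?D \<and> x - y \<in> ?L"
    proof (rule ex1I[of _ y])
      show "y \<in> ?D \<and> x - y \<in> ?L"
        using y(2) yS x by (auto simp: inner_diff_left frac_ge_0 frac_lt_1 frac_def span_diff) linarith+
      fix z assume z: "z \<in> ?D \<and> x - z \<in> ?L"
      have "z - y = 0"
      proof (rule inner_span_eq_0[of _ B])
        fix b assume b: "b \<in> B"
        have "x \<bullet> b - y \<bullet> b \<in> \<int>" using y(2)[OF b] by (simp add: frac_def)
        moreover have "x \<bullet> b - z \<bullet> b \<in> \<int>" using z b by (auto simp: inner_diff_left)
        ultimately have "(x \<bullet> b - y \<bullet> b) - (x \<bullet> b - z \<bullet> b) \<in> \<int>" by (rule Ints_diff)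
        then have "(z - y) \<bullet> b \<in> \<int>" by (simp add: inner_diff_left)
        moreover have "\<bar>(z - y) \<bullet> b\<bar> < 1"
        proof -
          have "0 \<le> z \<bullet> b" "z \<bullet> b < 1" using z b by auto
          then show ?thesis
            unfolding inner_diff_left y(2)[OF b] using frac_ge_0[of "x \<bullet> b"] frac_lt_1[of "x \<bullet> b"] by linarith
        qed
        ultimately show "(z - y) \<bullet> b = 0" using Ints_nonzero_abs_less1 by blast
      qed (use z yS in \<open>auto intro: span_diff\<close>)
      then show "z = y" by simp
    qed
  qed auto
  moreover have "countable ?L"
  proof (rule countable_image_inj_on)
    \<comment> \<open>Coordinates of lattice vectors are integers, so the floors lose no information
      and embed the lattice into the integer functions on B.\<close>
    let ?f = "\<lambda>x. \<lambda>b\<in>B. \<lfloor>x \<bullet> b\<rfloor>"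
    show "inj_on ?f ?L"
    proof (rule inj_onI)
      fix x y assume x: "x \<in> ?L" and y: "y \<in> ?L" and eq: "?f x = ?f y"
      have "x \<bullet> b = y \<bullet> b" if b: "b \<in> B" for b
      proof -
        have "\<lfloor>x \<bullet> b\<rfloor> = \<lfloor>y \<bullet> b\<rfloor>" using fun_cong[OF eq, of b] b by simp
        moreover have "x \<bullet> b \<in> \<int>" "y \<bullet> b \<in> \<int>" using x y b by auto
        ultimately show ?thesis by (metis floor_of_int Ints_cases)
      qed
      then show "x = y" using expand[of x] expand[of y] x y by simp
    qed
    have "?f ` ?L \<subseteq> Pi\<^sub>E B (\<lambda>_. UNIV)" by auto
    then show "countable (?f ` ?L)"
      by (rule countable_subset) (intro countable_PiE B(1) countableI_type)
  qed
  ultimately show ?thesis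
    by unfold_locales (auto simp: plus_subgroup_def span_diff inner_diff_left subspace_span span_zero)
qed

section \<open>Traces and circuits\<close>

lemma oinv_oinv [simp]: "oinv (oinv a) = a"
  by (simp add: oinv_def)

lemma feeds_iff: "feeds G a b \<longleftrightarrow> oinit G b = oterm G a \<and> b \<noteq> oinv a"
  by (auto simp: feeds_def)

lemma pairing_0 [simp]: "pairing G \<omega> 0 = 0"
  and pairing_add: "pairing G \<omega> (\<alpha> + \<beta>) = pairing G \<omega> \<alpha> + pairing G \<omega> \<beta>"
  and pairing_minus: "pairing G (- \<omega>) \<alpha> = - pairing G \<omega> \<alpha>"
  by (simp_all add: pairing_def algebra_simps sum.distrib sum_negf)

lemma chi_0 [simp]: "chi G \<omega> 0 = 1"
  and chi_add: "chi G \<omega> (\<alpha> + \<beta>) = chi G \<omega> \<alpha> * chi G \<omega> \<beta>"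
  by (simp_all add: chi_def pairing_add distrib_left exp_add)

lemma Cab_Nil [simp]: "Cab [] = 0" and Cab_Cons: "Cab (a # as) = ovec a + Cab as"
  by (simp_all add: Cab_def)

text \<open>The starting edge is not listed, while the final edge b is. This matches the weight in
  \<open>W1\<close>, where the entry at (a, b) carries the character of b only, so the listed edges
  account for the whole weight of a walk.\<close>

fun nbwalk :: "('v, 'e) pre_digraph \<Rightarrow> 'e \<times> bool \<Rightarrow> ('e \<times> bool) list \<Rightarrow> 'e \<times> bool \<Rightarrow> bool" where
  "nbwalk G a [] b \<longleftrightarrow> a = b"
| "nbwalk G a (x # xs) b \<longleftrightarrow> feeds G a x \<and> nbwalk G x xs b"

definition nbwalks :: "('v, 'e) pre_digraph \<Rightarrow> nat \<Rightarrow> 'e \<times> bool \<Rightarrow> 'e \<times> bool \<Rightarrow> ('e \<times> bool) list set" where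
  "nbwalks G l a b = {as. set as \<subseteq> oedges G \<and> length as = l \<and> nbwalk G a as b}"

lemma nbwalk_iff_nth:
  assumes "as \<noteq> []"
  shows "nbwalk G a as b \<longleftrightarrow>
    last as = b \<and> feeds G a (hd as) \<and> (\<forall>i. Suc i < length as \<longrightarrow> feeds G (as ! i) (as ! Suc i))"
  using assms
proof (induction as arbitrary: a)
  case (Cons x xs)
  show ?case
  proof (cases "xs = []")
    case False
    have *: "(\<forall>i. Suc i < length (x # xs) \<longrightarrow> feeds G ((x # xs) ! i) ((x # xs) ! Suc i)) \<longleftrightarrow>
      feeds G x (hd xs) \<and> (\<forall>i. Suc i < length xs \<longrightarrow> feeds G (xs ! i) (xs ! Suc i))" (is "?l = ?r")
    proof
      assume l: ?l
      have "feeds G x (hd xs)" using spec[OF l, of 0] False by (simp add: hd_conv_nth)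
      moreover have "feeds G (xs ! i) (xs ! Suc i)" if "Suc i < length xs" for i
        using spec[OF l, of "Suc i"] that by simp
      ultimately show ?r by blast
    next
      assume r: ?r
      show ?l
      proof (intro allI impI)
        fix i assume "Suc i < length (x # xs)"
        then show "feeds G ((x # xs) ! i) ((x # xs) ! Suc i)"
          using r False by (cases i) (auto simp: hd_conv_nth)
      qed
    qed
    show ?thesis
      unfolding * nbwalk.simps Cons.IH[OF False] list.sel last_ConsR[OF False] by blast
  qed (simp add: conj_commute)
qed simp

context
  fixes G :: "('v, 'e::finite) pre_digraph"
begin

lemma finite_oedges [simp]: "finite (oedges G)"
  by simp

lemma finite_nbwalks: "finite (nbwalks G l a b)"
  by (rule finite_subset[OF _ finite_lists_length_eq[OF finite_oedges, of l]]) (auto simp: nbwalks_def)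

lemma finite_circuits: "finite (circuits G l)"
  by (rule finite_subset[OF _ finite_lists_length_eq[OF finite_oedges, of l]]) (auto simp: circuits_def)

text \<open>As the starting edge is not listed, a closed walk lists its base edge at the end. The
  first step, from the last listed edge to the first, then encodes closure and the absence of a
  tail.\<close>

lemma nbwalk_closed_iff_circuit:
  assumes "l \<ge> 1"
  shows "as \<in> nbwalks G l a a \<longleftrightarrow> as \<in> circuits G l \<and> last as = a"
proof (cases "as = []")
  case False
  have "feeds G (last as) (hd as) \<longleftrightarrow> oterm G (last as) = oinit G (hd as) \<and> last as \<noteq> oinv (hd as)"
    unfolding feeds_def by (metis oinv_oinv)
  then show ?thesis
    using False unfolding nbwalks_def circuits_def mem_Collect_eq nbwalk_iff_nth[OF False]
    by (auto simp: feeds_iff)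
qed (use assms in \<open>auto simp: nbwalks_def circuits_def\<close>)

lemma oedge_enum: "bij_betw (oedge_enum G) {0..<2 * card (arcs G)} (oedges G)"
proof -
  have "card (oedges G) = 2 * card (arcs G)"
    by (simp add: oedges_def card_cartesian_product card_UNIV_bool)
  then have "\<exists>h. bij_betw h {0..<2 * card (arcs G)} (oedges G)"
    using ex_bij_betw_nat_finite[OF finite_oedges] by simp
  then show ?thesis unfolding oedge_enum_def by (rule someI_ex)
qed

lemma W1_carrier [simp]: "W1 G \<omega> \<in> carrier_mat (2 * card (arcs G)) (2 * card (arcs G))"
  by (simp add: W1_def)

lemma W1_index:
  assumes "i < 2 * card (arcs G)" "j < 2 * card (arcs G)"
  shows "W1 G \<omega> $$ (i, j) =
    (if feeds G (oedge_enum G i) (oedge_enum G j) then chi G \<omega> (ovec (oedge_enum G j)) else 0)"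
  using assms by (simp add: W1_def)

text \<open>Matrix powers grow by a factor on the right, whereas \<open>nbwalk\<close> recurses on
  the first edge.\<close>

lemma pow_mat_Suc_left:
  assumes "A \<in> carrier_mat n n"
  shows "A ^\<^sub>m Suc l = A * A ^\<^sub>m l"
proof (induction l)
  case 0
  then show ?case using assms by simp
next
  case (Suc l)
  have "A ^\<^sub>m Suc (Suc l) = (A * A ^\<^sub>m l) * A" using Suc by simp
  also have "\<dots> = A * (A ^\<^sub>m l * A)"
    by (rule assoc_mult_mat[of _ n n _ n _ n]) (use assms in simp_all)
  finally show ?case by simp
qed

text \<open>Splitting off the left matrix factor removes the first listed edge of a walk, and the
  weights multiply because the character turns sums of chains into products.\<close>

lemma W1_pow_entry:
  assumes "i < 2 * card (arcs G)" "j < 2 * card (arcs G)"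
  shows "(W1 G \<omega> ^\<^sub>m l) $$ (i, j) = (\<Sum>as\<in>nbwalks G l (oedge_enum G i) (oedge_enum G j). chi G \<omega> (Cab as))"
  using assms
proof (induction l arbitrary: i)
  case 0
  \<comment> \<open>The empty walk joins only an edge to itself; injectivity of the enumeration
    turns this into the identity matrix.\<close>
  have eq: "nbwalks G 0 (oedge_enum G i) (oedge_enum G j) = (if i = j then {[]} else {})"
  proof -
    have "oedge_enum G i = oedge_enum G j \<longleftrightarrow> i = j"
      by (rule inj_on_eq_iff[OF bij_betw_imp_inj_on[OF oedge_enum]]) (use 0 in auto)
    then show ?thesis by (auto simp: nbwalks_def)
  qed
  show ?case using 0 by (simp add: eq W1_def)
next
  case (Suc l)
  let ?n = "2 * card (arcs G)" and ?h = "oedge_enum G"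
  have "(W1 G \<omega> ^\<^sub>m Suc l) $$ (i, j) = (\<Sum>k = 0..<?n. W1 G \<omega> $$ (i, k) * (W1 G \<omega> ^\<^sub>m l) $$ (k, j))"
    unfolding pow_mat_Suc_left[OF W1_carrier] using Suc.prems pow_carrier_mat[OF W1_carrier[of \<omega>], of l]
    by (subst index_mult_mat) (auto simp: scalar_prod_def W1_def intro!: sum.cong)
  also have "\<dots> = (\<Sum>k = 0..<?n. (if feeds G (?h i) (?h k) then chi G \<omega> (ovec (?h k)) else 0) *
      (\<Sum>as\<in>nbwalks G l (?h k) (?h j). chi G \<omega> (Cab as)))"
    by (intro sum.cong refl arg_cong2[where f = "(*)"] W1_index Suc) (use Suc.prems in auto)
  also have "\<dots> = (\<Sum>x\<in>oedges G. (if feeds G (?h i) x then chi G \<omega> (ovec x) else 0) *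
      (\<Sum>as\<in>nbwalks G l x (?h j). chi G \<omega> (Cab as)))"
    by (rule sum.reindex_bij_betw[OF oedge_enum])
  \<comment> \<open>The feeding condition moves from the coefficient into the index set, so that the
    pairs (x, as) become exactly the walks with first listed edge x.\<close>
  also have "\<dots> = (\<Sum>x\<in>oedges G. \<Sum>as\<in>(if feeds G (?h i) x then nbwalks G l x (?h j) else {}).
      chi G \<omega> (Cab (x # as)))"
    by (intro sum.cong) (auto simp: Cab_Cons chi_add sum_distrib_left)
  also have "\<dots> = (\<Sum>(x, as)\<in>(SIGMA x:oedges G. if feeds G (?h i) x then nbwalks G l x (?h j) else {}).
      chi G \<omega> (Cab (x # as)))"
    by (rule sum.Sigma) (auto simp: finite_nbwalks)
  also have "\<dots> = (\<Sum>as\<in>nbwalks G (Suc l) (?h i) (?h j). chi G \<omega> (Cab as))"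
  proof -
    let ?S = "SIGMA x:oedges G. if feeds G (?h i) x then nbwalks G l x (?h j) else {}"
    have "nbwalks G (Suc l) (?h i) (?h j) = (\<lambda>(x, as). x # as) ` ?S"
    proof (intro equalityI subsetI)
      fix as assume as: "as \<in> nbwalks G (Suc l) (?h i) (?h j)"
      then obtain x xs where xs: "as = x # xs" by (cases as) (auto simp: nbwalks_def)
      then have "(x, xs) \<in> ?S" using as by (simp add: nbwalks_def)
      then show "as \<in> (\<lambda>(x, as). x # as) ` ?S" using xs by force
    next
      fix as assume "as \<in> (\<lambda>(x, as). x # as) ` ?S"
      then obtain x xs where "as = x # xs" "(x, xs) \<in> ?S" by auto
      then show "as \<in> nbwalks G (Suc l) (?h i) (?h j)" by (simp add: nbwalks_def split: if_splits)
    qed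
    moreover have "inj_on (\<lambda>(x, as). x # as) ?S" by (auto simp: inj_on_def)
    ultimately show ?thesis by (simp only: sum.reindex comp_def case_prod_unfold)
  qed
  finally show ?case .
qed

text \<open>A diagonal entry collects the circuits ending in one fixed edge, so the trace meets
  every circuit once. Length 0 is excluded because the trace of the identity is the number of
  oriented edges, while there are no empty circuits.\<close>

theorem K_eq_sum_circuits:
  assumes "l \<ge> 1"
  shows "K G \<omega> l = (\<Sum>as\<in>circuits G l. chi G \<omega> (Cab as))"
proof -
  let ?n = "2 * card (arcs G)" and ?h = "oedge_enum G"
  have "K G \<omega> l = (\<Sum>i = 0..<?n. (W1 G \<omega> ^\<^sub>m l) $$ (i, i))"
    unfolding K_def mat_trace_def diag_mat_def
    using carrier_matD(1)[OF pow_carrier_mat[OF W1_carrier[of \<omega>], of l]]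
    by (simp only: interv_sum_list_conv_sum_set_nat set_upt)
  also have "\<dots> = (\<Sum>i = 0..<?n. \<Sum>as\<in>nbwalks G l (?h i) (?h i). chi G \<omega> (Cab as))"
    by (intro sum.cong) (auto simp: W1_pow_entry)
  also have "\<dots> = (\<Sum>a\<in>oedges G. \<Sum>as\<in>nbwalks G l a a. chi G \<omega> (Cab as))"
    by (rule sum.reindex_bij_betw[OF oedge_enum])
  also have "\<dots> = (\<Sum>a\<in>oedges G. \<Sum>as\<in>{as \<in> circuits G l. last as = a}. chi G \<omega> (Cab as))"
    using nbwalk_closed_iff_circuit[OF assms] by (intro sum.cong) auto
  also have "\<dots> = (\<Sum>as\<in>circuits G l. chi G \<omega> (Cab as))"
    by (rule sum.group[OF finite_circuits finite_oedges]) (auto simp: circuits_def)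
  finally show ?thesis .
qed

end

section \<open>Harmonic forms and homology\<close>

lemma unit_char_conv_chi: "pairing G \<omega> \<alpha> = \<eta> \<bullet> \<alpha> \<Longrightarrow> chi G \<omega> \<alpha> = unit_char \<eta> \<alpha>"
  by (simp add: chi_def unit_char_def)

context
  fixes G :: "('v, 'e::finite) pre_digraph"
begin

lemma pairing_eq_inner:
  assumes "\<omega> \<in> forms G \<or> \<alpha> \<in> forms G"
  shows "pairing G \<omega> \<alpha> = \<omega> \<bullet> \<alpha>"
  unfolding pairing_def inner_vec_def inner_real_def
  by (rule sum.mono_neutral_left) (use assms in \<open>auto simp: forms_def\<close>)

lemma subspace_forms: "subspace (forms G)"
  by (auto simp: forms_def subspace_def)

lemma chains_eq_forms: "chains G = forms G"
proof
  show "chains G \<subseteq> forms G"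
    unfolding chains_def by (rule span_minimal[OF _ subspace_forms]) (auto simp: forms_def axis_def)
  show "forms G \<subseteq> chains G"
  proof
    fix x assume x: "x \<in> forms G"
    have "x = (\<Sum>e\<in>UNIV. x $ e *\<^sub>R axis e 1)"
      using basis_expansion[of x] by (simp add: scalar_mult_eq_scaleR)
    also have "\<dots> = (\<Sum>e\<in>arcs G. x $ e *\<^sub>R axis e 1)"
      by (rule sum.mono_neutral_right) (use x in \<open>auto simp: forms_def\<close>)
    also have "\<dots> \<in> chains G"
      unfolding chains_def by (intro span_sum span_scale span_base) auto
    finally show "x \<in> chains G" .
  qed
qed

lemma boundary_add: "boundary G (x + y) v = boundary G x v + boundary G y v"
  and boundary_scaleR: "boundary G (c *\<^sub>R x) v = c * boundary G x v"
  and boundary_0 [simp]: "boundary G 0 v = 0"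
  by (simp_all add: boundary_def sum.distrib sum_distrib_left right_diff_distrib)

lemma harmonic_eq: "harmonic G = {\<omega> \<in> forms G. \<forall>v\<in>verts G. boundary G \<omega> v = 0}"
  by (auto simp: harmonic_def boundary_def)

lemma subspace_harmonic: "subspace (harmonic G)"
  using subspace_forms
  by (auto simp: harmonic_eq subspace_def boundary_add boundary_scaleR)

lemma harmonic_forms: "harmonic G \<subseteq> forms G"
  by (auto simp: harmonic_def)

text \<open>In orthonormal coordinates, chains and forms are the same vectors and harmonicity is the
  cycle condition. Homology thus consists of the integer points of \<open>harmonic G\<close>, and it
  shares one Euclidean space with its dual lattice.\<close>

lemma H1_eq: "H1 G = {\<alpha> \<in> harmonic G. \<forall>e. \<alpha> $ e \<in> \<int>}"
  unfolding H1_def harmonic_eq chains_eq_forms by (auto simp: forms_def)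

text \<open>
  A harmonic form is approximated by rational vectors \<open>p / q\<close> so well that the boundary of \<open>p\<close>,
  being integral, has to vanish.
\<close>
lemma span_H1: "span (H1 G) = harmonic G"
proof
  show "span (H1 G) \<subseteq> harmonic G"
    by (rule span_minimal[OF _ subspace_harmonic]) (auto simp: H1_eq)
  have "x \<in> closure (span (H1 G))" if x: "x \<in> harmonic G" for x
    unfolding closure_approachable
  proof (intro allI impI)
    fix \<epsilon> :: real assume \<epsilon>: "\<epsilon> > 0"
    define n where "n = real CARD('e)"
    have n: "n \<ge> 1" unfolding n_def using zero_less_card_finite[where 'a = 'e] by linarith
    \<comment> \<open>The bound \<open>N > 2 * n\<close> brings the boundary of p, at most
      \<open>2 * n / N\<close>, below 1; the bound \<open>N > n / \<epsilon>\<close> brings the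
      distance to x below \<epsilon>.\<close>
    obtain N where N: "real N > max (2 * n) (n / \<epsilon>)" using reals_Archimedean2 by blast
    have N0: "N > 0" using N n by (cases N) auto
    obtain q :: int and p :: "real ^ 'e" where qp: "q > 0" "\<And>e. p $ e \<in> \<int>"
      "\<And>e. \<bar>of_int q * x $ e - p $ e\<bar> < 1 / N" "\<And>e. x $ e = 0 \<Longrightarrow> p $ e = 0"
      using vec_Dirichlet_approx[OF N0] by metis
    define r where "r = p - of_int q *\<^sub>R x"
    have r: "\<bar>r $ e\<bar> < 1 / N" for e using qp(3)[of e] by (simp add: r_def abs_minus_commute)
    have sr: "\<bar>\<Sum>e\<in>A. r $ e\<bar> \<le> n / N" for A
    proof -
      have "\<bar>\<Sum>e\<in>A. r $ e\<bar> \<le> (\<Sum>e\<in>A. \<bar>r $ e\<bar>)" by (rule sum_abs)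
      also have "\<dots> \<le> (\<Sum>e\<in>A. 1 / N)" using r by (intro sum_mono less_imp_le)
      also have "\<dots> \<le> (\<Sum>e\<in>(UNIV :: 'e set). 1 / N)" by (rule sum_mono2) auto
      finally show ?thesis by (simp add: n_def)
    qed
    have "boundary G p v = 0" if v: "v \<in> verts G" for v
    proof -
      have "boundary G p v = boundary G r v"
      proof -
        have "boundary G p v = boundary G (r + of_int q *\<^sub>R x) v" by (simp add: r_def)
        then show ?thesis using x v by (simp add: boundary_add boundary_scaleR harmonic_eq)
      qed
      also have "\<bar>\<dots>\<bar> \<le> n / N + n / N"
        unfolding boundary_def by (rule order_trans[OF abs_triangle_ineq4 add_mono[OF sr sr]])
      also have "\<dots> < 1" using N N0 by (simp add: field_simps)
      finally have "\<bar>boundary G p v\<bar> < 1" .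
      moreover have "boundary G p v \<in> \<int>"
        unfolding boundary_def using qp(2) by (intro Ints_diff Ints_sum)
      ultimately show ?thesis using Ints_nonzero_abs_less1 by blast
    qed
    then have "p \<in> H1 G"
      using qp x by (auto simp: H1_eq harmonic_eq forms_def)
    then have "(1 / of_int q) *\<^sub>R p \<in> span (H1 G)" by (intro span_scale span_base)
    moreover have "dist ((1 / of_int q) *\<^sub>R p) x < \<epsilon>"
    proof -
      have q1: "real_of_int q \<ge> 1" using qp(1) by simp
      have "(1 / of_int q) *\<^sub>R p - x = (1 / of_int q) *\<^sub>R r"
        using qp(1) by (simp add: r_def algebra_simps)
      then have "dist ((1 / of_int q) *\<^sub>R p) x = norm r / of_int q"
        using qp(1) by (simp add: dist_norm)
      also have "\<dots> \<le> norm r" using q1 mult_left_mono[OF q1 norm_ge_zero[of r]] by (simp add: divide_le_eq)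
      also have "\<dots> \<le> (\<Sum>e\<in>UNIV. \<bar>r $ e\<bar>)" by (rule norm_le_l1_cart)
      also have "\<dots> \<le> (\<Sum>e\<in>(UNIV :: 'e set). 1 / N)" using r by (intro sum_mono less_imp_le)
      also have "\<dots> < \<epsilon>" using N N0 \<epsilon> by (simp add: n_def field_simps)
      finally show ?thesis .
    qed
    ultimately show "\<exists>y\<in>span (H1 G). dist y x < \<epsilon>" by blast
  qed
  \<comment> \<open>Density is enough, since subspaces of a finite-dimensional space are
    closed.\<close>
  moreover have "closure (span (H1 G)) = span (H1 G)"
    by (simp add: closed_subspace closure_closed)
  ultimately show "harmonic G \<subseteq> span (H1 G)" by blast
qed

lemma boundary_ovec:
  assumes "a \<in> oedges G"
  shows "boundary G (ovec a) v = of_bool (oterm G a = v) - of_bool (oinit G a = v)"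
proof -
  have s: "(\<Sum>e | e \<in> arcs G \<and> P e. axis f (1::real) $ e) = of_bool (P f)" if "f \<in> arcs G" for P and f :: 'e
    using that by (simp add: axis_def sum.delta' if_distrib cong: if_cong)
  have m: "(- axis f (1::real)) $ e = - (axis f 1 $ e)" for f e :: 'e by simp
  show ?thesis using assms
    by (auto simp: boundary_def ovec_def oedges_def oterm_def oinit_def s sum_negf)
qed

text \<open>The sum telescopes, each listed edge beginning where its predecessor ends. The unlisted
  starting edge contributes only its terminal vertex.\<close>

lemma boundary_nbwalk:
  assumes "set as \<subseteq> oedges G" "nbwalk G a as b"
  shows "boundary G (Cab as) v = of_bool (oterm G b = v) - of_bool (oterm G a = v)"
  using assms
  by (induction as arbitrary: a) (auto simp: Cab_Cons boundary_add boundary_ovec feeds_def)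

lemma Cab_in_H1:
  assumes "as \<in> circuits G l"
  shows "Cab as \<in> H1 G"
proof -
  have l: "l \<ge> 1" and as: "set as \<subseteq> oedges G"
    using assms by (auto simp: circuits_def Suc_le_eq)
  have walk: "nbwalk G (last as) as (last as)"
    using nbwalk_closed_iff_circuit[OF l, where G = G and as = as and a = "last as"] assms by (simp add: nbwalks_def)
  have int: "Cab as $ e \<in> \<int>" for e
    by (induction as) (auto simp: Cab_Cons ovec_def axis_def intro!: Ints_add)
  have "Cab as $ e = 0" if "e \<notin> arcs G" for e
    using as that by (induction as) (auto simp: Cab_Cons ovec_def oedges_def axis_def)
  then show ?thesis
    using int boundary_nbwalk[OF as walk] by (auto simp: H1_eq harmonic_eq forms_def)
qed

end

section \<open>The orthogonal decomposition into harmonic and exact forms\<close>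

context
  fixes G :: "('v, 'e::finite) pre_digraph"
  assumes G: "fin_digraph G"
begin

interpretation fin_digraph G by (rule G)

text \<open>Summation by parts: grouping the arcs by head and by tail shows that
  \<open>boundary\<close> is adjoint to \<open>dform\<close>.\<close>

lemma inner_dform:
  assumes "\<eta> \<in> forms G"
  shows "dform G f \<bullet> \<eta> = (\<Sum>v\<in>verts G. f v * boundary G \<eta> v)"
proof -
  have "dform G f \<bullet> \<eta> = (\<Sum>e\<in>arcs G. (f (head G e) - f (tail G e)) * \<eta> $ e)"
    unfolding inner_vec_def inner_real_def
    by (rule sum.mono_neutral_cong_right) (auto simp: dform_def)
  also have "\<dots> = (\<Sum>e\<in>arcs G. f (head G e) * \<eta> $ e) - (\<Sum>e\<in>arcs G. f (tail G e) * \<eta> $ e)"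
    by (simp add: left_diff_distrib sum_subtractf)
  also have "(\<Sum>e\<in>arcs G. f (head G e) * \<eta> $ e)
      = (\<Sum>v\<in>verts G. \<Sum>e | e \<in> arcs G \<and> head G e = v. f (head G e) * \<eta> $ e)"
    by (rule sum.group[symmetric]) auto
  also have "\<dots> = (\<Sum>v\<in>verts G. f v * (\<Sum>e | e \<in> arcs G \<and> head G e = v. \<eta> $ e))"
    by (auto simp: sum_distrib_left intro!: sum.cong)
  also have "(\<Sum>e\<in>arcs G. f (tail G e) * \<eta> $ e)
      = (\<Sum>v\<in>verts G. \<Sum>e | e \<in> arcs G \<and> tail G e = v. f (tail G e) * \<eta> $ e)"
    by (rule sum.group[symmetric]) auto
  also have "\<dots> = (\<Sum>v\<in>verts G. f v * (\<Sum>e | e \<in> arcs G \<and> tail G e = v. \<eta> $ e))"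
    by (auto simp: sum_distrib_left intro!: sum.cong)
  finally show ?thesis by (simp add: boundary_def right_diff_distrib sum_subtractf)
qed

lemma subspace_exact: "subspace (exact G)"
proof -
  have *: "dform G (\<lambda>v. 0) = 0" "dform G f + dform G g = dform G (\<lambda>v. f v + g v)"
    "c *\<^sub>R dform G f = dform G (\<lambda>v. c * f v)" for f g c
    by (auto simp: dform_def vec_eq_iff algebra_simps)
  show ?thesis
    unfolding exact_def
    by (rule subspaceI) (auto simp: * intro: range_eqI[of _ "dform G" "\<lambda>v. 0"])
qed

lemma exact_forms: "exact G \<subseteq> forms G"
  by (auto simp: exact_def dform_def forms_def)

lemma inner_exact_harmonic:
  assumes "x \<in> exact G" "\<eta> \<in> harmonic G"
  shows "x \<bullet> \<eta> = 0"
  using assms inner_dform[of \<eta>] by (auto simp: exact_def harmonic_eq)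

text \<open>Pairing with the differential of the indicator function of a vertex isolates the
  boundary at that vertex.\<close>

lemma harmonic_if_orthogonal_exact:
  assumes "z \<in> forms G" "\<And>x. x \<in> exact G \<Longrightarrow> x \<bullet> z = 0"
  shows "z \<in> harmonic G"
  unfolding harmonic_eq
proof (intro CollectI conjI ballI assms(1))
  fix v assume v: "v \<in> verts G"
  have "0 = dform G (\<lambda>w. of_bool (w = v)) \<bullet> z" using assms(2) by (simp add: exact_def)
  also have "\<dots> = (\<Sum>w\<in>verts G. if w = v then boundary G z v else 0)"
    unfolding inner_dform[OF assms(1)] by (intro sum.cong) auto
  finally show "boundary G z v = 0" using v by simp
qed

text \<open>Existence is orthogonal projection along the exact forms. Two candidates differ by a
  form that is both harmonic and exact, hence orthogonal to itself.\<close>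

lemma phi1_unique:
  assumes "\<omega> \<in> forms G"
  shows "\<exists>!\<eta>. \<eta> \<in> harmonic G \<and> \<omega> - \<eta> \<in> exact G"
proof -
  obtain y z where yz: "y \<in> span (exact G)" "\<And>w. w \<in> span (exact G) \<Longrightarrow> orthogonal z w" "\<omega> = y + z"
    by (metis orthogonal_subspace_decomp_exists)
  have y: "y \<in> exact G" using yz(1) subspace_exact by (metis span_eq_iff)
  have "z = \<omega> - y" using yz(3) by simp
  then have "z \<in> forms G" using assms y exact_forms subspace_diff[OF subspace_forms, of \<omega> G y] by auto
  then have z: "z \<in> harmonic G"
    using yz(2) by (intro harmonic_if_orthogonal_exact) (auto simp: orthogonal_def span_base inner_commute)
  show ?thesis
  proof (rule ex1I[of _ z])
    show "z \<in> harmonic G \<and> \<omega> - z \<in> exact G" using z y yz(3) by simp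
    fix \<eta> assume \<eta>: "\<eta> \<in> harmonic G \<and> \<omega> - \<eta> \<in> exact G"
    have "y - (\<omega> - \<eta>) \<in> exact G"
      by (rule subspace_diff[OF subspace_exact y conjunct2[OF \<eta>]])
    then have "\<eta> - z \<in> exact G" using yz(3) by simp
    moreover have "\<eta> - z \<in> harmonic G" using \<eta> z subspace_diff[OF subspace_harmonic] by blast
    ultimately have "(\<eta> - z) \<bullet> (\<eta> - z) = 0" by (rule inner_exact_harmonic)
    then show "\<eta> = z" by simp
  qed
qed

lemma phi1:
  assumes "\<omega> \<in> forms G"
  shows "phi1 G \<omega> \<in> harmonic G" "\<omega> - phi1 G \<omega> \<in> exact G"
  using theI'[OF phi1_unique[OF assms]] by (simp_all add: phi1_def)

lemma phi1_harmonic: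
  assumes "\<eta> \<in> harmonic G"
  shows "phi1 G \<eta> = \<eta>"
  unfolding phi1_def
proof (rule the1_equality)
  show "\<exists>!\<zeta>. \<zeta> \<in> harmonic G \<and> \<eta> - \<zeta> \<in> exact G"
    using assms harmonic_forms by (intro phi1_unique) blast
  show "\<eta> \<in> harmonic G \<and> \<eta> - \<eta> \<in> exact G"
    using assms subspace_0[OF subspace_exact] by simp
qed

lemma pairing_phi1:
  assumes "\<omega> \<in> forms G" "\<alpha> \<in> harmonic G"
  shows "pairing G \<omega> \<alpha> = phi1 G \<omega> \<bullet> \<alpha>"
proof -
  have "pairing G \<omega> \<alpha> = \<omega> \<bullet> \<alpha>" using assms by (simp add: pairing_eq_inner)
  moreover have "(\<omega> - phi1 G \<omega>) \<bullet> \<alpha> = 0"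
    using inner_exact_harmonic phi1[OF assms(1)] assms(2) by blast
  ultimately show ?thesis by (simp add: inner_diff_left)
qed

end

section \<open>Quotient groups\<close>

lemma subspace_plus_subgroup: "subspace A \<Longrightarrow> plus_subgroup A"
  using subspace_0[of A] subspace_diff[of A] unfolding plus_subgroup_def by blast

lemma comm_group_add_grp:
  assumes "plus_subgroup A"
  shows "comm_group (add_grp A)"
proof (rule comm_groupI)
  fix x y z assume *: "x \<in> carrier (add_grp A)" "y \<in> carrier (add_grp A)" "z \<in> carrier (add_grp A)"
  show "x \<otimes>\<^bsub>add_grp A\<^esub> y \<in> carrier (add_grp A)"
    using * plus_subgroup_add[OF assms] by (simp add: add_grp_def)
  show "x \<otimes>\<^bsub>add_grp A\<^esub> y \<otimes>\<^bsub>add_grp A\<^esub> z = x \<otimes>\<^bsub>add_grp A\<^esub> (y \<otimes>\<^bsub>add_grp A\<^esub> z)"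
    by (simp add: add_grp_def add.assoc)
  show "x \<otimes>\<^bsub>add_grp A\<^esub> y = y \<otimes>\<^bsub>add_grp A\<^esub> x"
    by (simp add: add_grp_def add.commute)
  show "\<one>\<^bsub>add_grp A\<^esub> \<otimes>\<^bsub>add_grp A\<^esub> x = x"
    by (simp add: add_grp_def)
  show "\<exists>y\<in>carrier (add_grp A). y \<otimes>\<^bsub>add_grp A\<^esub> x = \<one>\<^bsub>add_grp A\<^esub>"
    using * plus_subgroup_neg[OF assms] by (intro bexI[of _ "- x"]) (simp_all add: add_grp_def)
next
  show "\<one>\<^bsub>add_grp A\<^esub> \<in> carrier (add_grp A)"
    using plus_subgroup_0[OF assms] by (simp add: add_grp_def)
qed

lemma inv_add_grp:
  assumes "plus_subgroup A" "x \<in> A"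
  shows "inv\<^bsub>add_grp A\<^esub> x = - x"
proof -
  interpret comm_group "add_grp A" by (rule comm_group_add_grp) fact
  show ?thesis
    by (rule inv_equality) (use assms plus_subgroup_neg[OF assms] in \<open>auto simp: add_grp_def\<close>)
qed

text \<open>Translates the group-theoretic hypothesis on \<Lambda> into closure properties of a set
  of vectors.\<close>

lemma subgroup_add_grp_iff:
  assumes "plus_subgroup A"
  shows "subgroup B (add_grp A) \<longleftrightarrow> plus_subgroup B \<and> B \<subseteq> A"
proof
  assume B: "subgroup B (add_grp A)"
  have BA: "B \<subseteq> A" using subgroup.subset[OF B] by (simp add: add_grp_def)
  have "0 \<in> B" using subgroup.one_closed[OF B] by (simp add: add_grp_def)
  moreover have "x - y \<in> B" if "x \<in> B" "y \<in> B" for x y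
    using subgroup.m_closed[OF B \<open>x \<in> B\<close> subgroup.m_inv_closed[OF B \<open>y \<in> B\<close>]] BA that
    by (simp add: inv_add_grp[OF assms] subsetD) (simp add: add_grp_def)
  ultimately show "plus_subgroup B \<and> B \<subseteq> A" using BA by (simp add: plus_subgroup_def)
next
  interpret comm_group "add_grp A" by (rule comm_group_add_grp) fact
  assume B: "plus_subgroup B \<and> B \<subseteq> A"
  show "subgroup B (add_grp A)"
  proof (rule subgroupI)
    fix a assume "a \<in> B"
    then show "inv\<^bsub>add_grp A\<^esub> a \<in> B"
      using B inv_add_grp[OF assms, of a] plus_subgroup_neg[of B a] by auto
  qed (use B plus_subgroup_0[of B] plus_subgroup_add[of B] in \<open>auto simp: add_grp_def\<close>)
qed

context
  fixes A B :: "'a::ab_group_add set"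
  assumes A: "plus_subgroup A" and B: "plus_subgroup B" and BA: "B \<subseteq> A"
begin

lemma add_grp_normal: "B \<lhd> add_grp A"
  by (rule comm_group.subgroup_imp_normal[OF comm_group_add_grp[OF A]])
    (simp add: subgroup_add_grp_iff A B BA)

lemma group_add_grp_Mod: "group (add_grp A Mod B)"
  by (rule normal.factorgroup_is_group[OF add_grp_normal])

lemma mult_add_grp_Mod:
  assumes "x \<in> A" "y \<in> A"
  shows "acoset B x \<otimes>\<^bsub>add_grp A Mod B\<^esub> acoset B y = acoset B (x + y)"
  using normal.rcos_sum[OF add_grp_normal, of x y] assms
  by (simp add: FactGroup_def) (simp add: add_grp_def)

lemma one_add_grp_Mod: "\<one>\<^bsub>add_grp A Mod B\<^esub> = acoset B 0"
  by (simp add: FactGroup_def acoset_def)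

lemma inv_add_grp_Mod:
  assumes "x \<in> A"
  shows "inv\<^bsub>add_grp A Mod B\<^esub> (acoset B x) = acoset B (- x)"
proof -
  interpret group "add_grp A Mod B" by (rule group_add_grp_Mod)
  have neg: "- x \<in> A" by (rule plus_subgroup_neg[OF A assms])
  show ?thesis
  proof (rule inv_equality)
    show "acoset B (- x) \<otimes>\<^bsub>add_grp A Mod B\<^esub> acoset B x = \<one>\<^bsub>add_grp A Mod B\<^esub>"
      unfolding mult_add_grp_Mod[OF neg assms] one_add_grp_Mod by simp
  qed (use assms neg in \<open>auto simp: carrier_add_grp_Mod\<close>)
qed

end

text \<open>Powers of a coset are cosets of multiples, and the order of a group annihilates each
  element. For an infinite quotient \<open>order\<close> is 0, and the claim reduces to
  \<open>0 \<in> B\<close>.\<close>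

lemma scaleR_order_Mod:
  fixes A B :: "'a::real_vector set"
  assumes A: "plus_subgroup A" and B: "plus_subgroup B" and BA: "B \<subseteq> A" and x: "x \<in> A"
  shows "of_nat (Coset.order (add_grp A Mod B)) *\<^sub>R x \<in> B"
proof -
  interpret group "add_grp A Mod B" by (rule group_add_grp_Mod[OF A B BA])
  have *: "of_nat n *\<^sub>R x \<in> A \<and> acoset B x [^]\<^bsub>add_grp A Mod B\<^esub> n = acoset B (of_nat n *\<^sub>R x)" for n :: nat
  proof (induction n)
    case 0
    show ?case by (simp add: acoset_def plus_subgroup_0[OF A])
  next
    case (Suc n)
    then have "of_nat n *\<^sub>R x + x \<in> A" using x plus_subgroup_add[OF A] by blast
    moreover have "of_nat (Suc n) *\<^sub>R x = of_nat n *\<^sub>R x + x" by (simp add: algebra_simps)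
    ultimately show ?case
      using Suc mult_add_grp_Mod[OF A B BA, of "of_nat n *\<^sub>R x" x] x by (simp only: nat_pow_Suc)
  qed
  have "acoset B (of_nat (Coset.order (add_grp A Mod B)) *\<^sub>R x) = acoset B 0"
    using *[of "Coset.order (add_grp A Mod B)"] pow_order_eq_1[of "acoset B x"] x
    unfolding carrier_add_grp_Mod one_add_grp_Mod[OF A B BA] by simp
  then show ?thesis by (simp add: acoset_eq_iff[OF B])
qed

text \<open>Translation by a permutes the group, so the sum equals itself times
  \<open>\<psi> a\<close>, which is not 1.\<close>

lemma (in group) sum_character_eq_0:
  fixes \<psi> :: "'a \<Rightarrow> complex"
  assumes mult: "\<And>x y. x \<in> carrier G \<Longrightarrow> y \<in> carrier G \<Longrightarrow> \<psi> (x \<otimes> y) = \<psi> x * \<psi> y"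
    and a: "a \<in> carrier G" "\<psi> a \<noteq> 1"
  shows "(\<Sum>x\<in>carrier G. \<psi> x) = 0"
proof -
  have bij: "bij_betw (\<lambda>x. a \<otimes> x) (carrier G) (carrier G)"
    by (rule bij_betwI[where g = "\<lambda>x. inv a \<otimes> x"]) (use a in \<open>auto simp: m_assoc[symmetric]\<close>)
  have "(\<Sum>x\<in>carrier G. \<psi> x) = (\<Sum>x\<in>carrier G. \<psi> (a \<otimes> x))"
    by (rule sum.reindex_bij_betw[OF bij, symmetric])
  also have "\<dots> = \<psi> a * (\<Sum>x\<in>carrier G. \<psi> x)"
    using a mult by (simp add: sum_distrib_left)
  finally show ?thesis using a(2) by simp
qed

context
  fixes G :: "('v, 'e::finite) pre_digraph"
begin

lemma plus_subgroup_H1: "plus_subgroup (H1 G)"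
  using subspace_plus_subgroup[OF subspace_harmonic[of G]]
  by (auto simp: H1_eq plus_subgroup_def)

lemma plus_subgroup_harmonic: "plus_subgroup (harmonic G)"
  by (rule subspace_plus_subgroup[OF subspace_harmonic])

lemma H1_harmonic: "H1 G \<subseteq> harmonic G"
  by (auto simp: H1_eq)

lemma dual_eq: "dual G \<Lambda> = {\<eta> \<in> harmonic G. \<forall>\<alpha>\<in>\<Lambda>. \<eta> \<bullet> \<alpha> \<in> \<int>}"
  unfolding dual_def using harmonic_forms[of G] by (auto simp: pairing_eq_inner)

lemma plus_subgroup_dual: "plus_subgroup (dual G \<Lambda>)"
  using plus_subgroup_harmonic by (auto simp: dual_eq plus_subgroup_def inner_diff_left)

lemma dual_harmonic: "dual G \<Lambda> \<subseteq> harmonic G"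
  by (auto simp: dual_eq)

text \<open>An integer basis of a full-rank sublattice is also a real basis of the harmonic forms,
  so integrality on \<Lambda> need only be tested on B. It serves both \<open>H1 G\<close> itself
  and its subgroups of finite index.\<close>

lemma integral_sublattice_basis:
  assumes "plus_subgroup \<Lambda>" "\<Lambda> \<subseteq> H1 G" "harmonic G \<subseteq> span \<Lambda>"
  obtains B where "finite B" "independent B" "\<Lambda> = int_comb B" "span B = harmonic G"
    "dual G \<Lambda> = {x \<in> span B. \<forall>b\<in>B. x \<bullet> b \<in> \<int>}"
proof -
  obtain B where B: "finite B" "independent B" "\<Lambda> = int_comb B"
    using integral_subgroup_basis[of \<Lambda>] assms(1,2) by (auto simp: plus_subgroup_def H1_eq subset_iff)
  have BL: "B \<subseteq> \<Lambda>" using base_in_int_comb[OF B(1)] B(3) by auto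
  have "span \<Lambda> \<subseteq> span B"
    using B(3) int_comb_subset_span[of B] span_mono[of \<Lambda> "span B"] by (simp add: span_span)
  moreover have "span B \<subseteq> harmonic G"
    using BL assms(2) H1_harmonic by (intro span_minimal subspace_harmonic) auto
  ultimately have sp: "span B = harmonic G" using assms(3) by auto
  have "dual G \<Lambda> = {x \<in> span B. \<forall>b\<in>B. x \<bullet> b \<in> \<int>}"
    using BL B(3) inner_int_comb_Ints[of B] by (auto simp: dual_eq sp)
  then show ?thesis using that B sp by blast
qed

lemma torus_harmonic: "torus (harmonic G) (dual G (H1 G))"
proof -
  have "harmonic G \<subseteq> span (H1 G)" by (simp add: span_H1)
  then obtain B where B: "finite B" "independent B"
    and eq: "span B = harmonic G" "dual G (H1 G) = {x \<in> span B. \<forall>b\<in>B. x \<bullet> b \<in> \<int>}"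
    by (rule integral_sublattice_basis[OF plus_subgroup_H1 subset_refl])
  show ?thesis using torus_dual_lattice[OF B] by (simp only: eq)
qed

lemma unit_char_dual_cong:
  assumes "\<eta> - \<eta>' \<in> dual G (H1 G)" "\<alpha> \<in> H1 G"
  shows "unit_char \<eta> \<alpha> = unit_char \<eta>' \<alpha>"
  using assms by (intro unit_char_cong) (simp add: dual_eq)

lemma uline_eq_iff: "uline G \<omega> = acoset (dual G (H1 G)) \<eta> \<longleftrightarrow> phi1 G \<omega> - \<eta> \<in> dual G (H1 G)"
  by (simp add: uline_def acoset_eq_iff[OF plus_subgroup_dual])

text \<open>Finitely many circuits have length l, so all but finitely many homology classes
  contribute 0.\<close>

lemma has_sum_circuits:
  assumes "l \<ge> 1"
  shows "((\<lambda>\<alpha>. chi G \<omega> \<alpha> * of_nat (Ncirc G \<alpha> l)) has_sum K G \<omega> l) (H1 G)"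
proof -
  let ?F = "Cab ` circuits G l"
  have F: "finite ?F" "?F \<subseteq> H1 G" using finite_circuits Cab_in_H1 by auto
  have "K G \<omega> l = (\<Sum>\<alpha>\<in>?F. \<Sum>as | as \<in> circuits G l \<and> Cab as = \<alpha>. chi G \<omega> (Cab as))"
    unfolding K_eq_sum_circuits[OF assms] by (rule sum.image_gen[OF finite_circuits])
  also have "\<dots> = (\<Sum>\<alpha>\<in>?F. chi G \<omega> \<alpha> * of_nat (Ncirc G \<alpha> l))"
    by (intro sum.cong) (auto simp: Ncirc_def)
  finally have "((\<lambda>\<alpha>. chi G \<omega> \<alpha> * of_nat (Ncirc G \<alpha> l)) has_sum K G \<omega> l) ?F"
    using has_sum_finite[OF F(1), of "\<lambda>\<alpha>. chi G \<omega> \<alpha> * of_nat (Ncirc G \<alpha> l)"] by simp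
  moreover have "((\<lambda>\<alpha>. chi G \<omega> \<alpha> * of_nat (Ncirc G \<alpha> l)) has_sum K G \<omega> l) (H1 G) \<longleftrightarrow>
    ((\<lambda>\<alpha>. chi G \<omega> \<alpha> * of_nat (Ncirc G \<alpha> l)) has_sum K G \<omega> l) ?F"
  proof (rule has_sum_cong_neutral)
    fix \<alpha> assume "\<alpha> \<in> H1 G - ?F"
    then have "{as \<in> circuits G l. Cab as = \<alpha>} = {}" by auto
    then show "chi G \<omega> \<alpha> * of_nat (Ncirc G \<alpha> l) = 0" unfolding Ncirc_def by (simp only: card.empty) simp
  qed (use F(2) in blast)+
  ultimately show ?thesis by blast
qed

end

section \<open>Class functions and inversion on the torus\<close>

context
  fixes G :: "('v, 'e::finite) pre_digraph"
  assumes G: "fin_digraph G"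
begin

lemma chi_eq_unit_char:
  assumes "\<omega> \<in> forms G" "\<alpha> \<in> H1 G"
  shows "chi G \<omega> \<alpha> = unit_char (phi1 G \<omega>) \<alpha>"
  by (intro unit_char_conv_chi pairing_phi1[OF G] assms(1) subsetD[OF H1_harmonic] assms(2))

lemma chi_minus_eq_unit_char:
  assumes "\<omega> \<in> forms G" "\<alpha> \<in> H1 G"
  shows "chi G (- \<omega>) \<alpha> = unit_char (phi1 G \<omega>) (- \<alpha>)"
  unfolding unit_char_minus chi_eq_unit_char[OF assms, symmetric]
  by (simp add: chi_def pairing_minus exp_minus)

lemma K_eq_sum_unit_char:
  assumes "l \<ge> 1" "\<omega> \<in> forms G"
  shows "K G \<omega> l = (\<Sum>as\<in>circuits G l. unit_char (phi1 G \<omega>) (Cab as))"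
  unfolding K_eq_sum_circuits[OF assms(1)]
  by (intro sum.cong chi_eq_unit_char assms(2) Cab_in_H1) auto

lemma uline_harmonic: "\<eta> \<in> harmonic G \<Longrightarrow> uline G \<eta> = acoset (dual G (H1 G)) \<eta>"
  by (simp add: uline_def phi1_harmonic[OF G])

text \<open>The harmonic representative \<eta> belongs to the class itself, so the condition inside
  \<open>on_class\<close> is not vacuous and determines the value.\<close>

lemma on_class_eq:
  assumes "\<eta> \<in> harmonic G"
    and "\<And>\<omega>. \<omega> \<in> forms G \<Longrightarrow> phi1 G \<omega> - \<eta> \<in> dual G (H1 G) \<Longrightarrow> f \<omega> = z"
  shows "on_class G f (acoset (dual G (H1 G)) \<eta>) = z"
  unfolding on_class_def
proof (rule the_equality)
  fix z' assume "\<forall>\<omega>\<in>forms G. uline G \<omega> = acoset (dual G (H1 G)) \<eta> \<longrightarrow> f \<omega> = z'"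
  then have "f \<eta> = z'" using uline_harmonic[OF assms(1)] harmonic_forms assms(1) by blast
  moreover have "f \<eta> = z"
    using assms(1) harmonic_forms[of G] plus_subgroup_0[OF plus_subgroup_dual, of G]
    by (intro assms(2)) (auto simp: phi1_harmonic[OF G])
  ultimately show "z' = z" by simp
qed (use assms(2) in \<open>auto simp: uline_eq_iff\<close>)

text \<open>Changing \<omega> within its class is harmless on \<open>H1 G\<close>, and changing
  \<alpha> within its coset is harmless because \<eta> is integral on \<Lambda>. The pair \<eta>,
  \<alpha> itself shows that the description is not vacuous.\<close>

lemma chi_cls_eq:
  assumes \<Lambda>: "plus_subgroup \<Lambda>" "\<Lambda> \<subseteq> H1 G" and \<eta>: "\<eta> \<in> dual G \<Lambda>" and \<alpha>: "\<alpha> \<in> H1 G"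
  shows "chi_cls G (acoset (dual G (H1 G)) \<eta>) (acoset \<Lambda> \<alpha>) = unit_char \<eta> \<alpha>"
  unfolding chi_cls_def
proof (rule the_equality)
  have \<eta>h: "\<eta> \<in> harmonic G" using \<eta> by (simp add: dual_eq)
  have "chi G \<omega> \<beta> = unit_char \<eta> \<alpha>"
    if \<omega>: "\<omega> \<in> forms G" and \<beta>: "\<beta> \<in> acoset \<Lambda> \<alpha>"
      and cls: "uline G \<omega> = acoset (dual G (H1 G)) \<eta>" for \<omega> \<beta>
  proof -
    have d: "\<beta> - \<alpha> \<in> \<Lambda>" using \<beta> by (simp add: mem_acoset_iff)
    have "(\<beta> - \<alpha>) + \<alpha> \<in> H1 G"
      by (rule plus_subgroup_add[OF plus_subgroup_H1 _ \<alpha>]) (use d \<Lambda>(2) in auto)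
    then have "\<beta> \<in> H1 G" by simp
    then have "chi G \<omega> \<beta> = unit_char \<eta> \<beta>"
      using chi_eq_unit_char[OF \<omega>] unit_char_dual_cong[of "phi1 G \<omega>" \<eta> G] cls uline_eq_iff[of G] by auto
    also have "\<dots> = unit_char \<eta> (\<beta> - \<alpha>) * unit_char \<eta> \<alpha>"
      by (simp flip: unit_char_add_right)
    also have "unit_char \<eta> (\<beta> - \<alpha>) = 1"
      using \<eta> d by (simp add: unit_char_eq_1_iff dual_eq)
    finally show ?thesis by simp
  qed
  then show all: "\<forall>\<omega>\<in>forms G. \<forall>\<beta>\<in>acoset \<Lambda> \<alpha>. uline G \<omega> = acoset (dual G (H1 G)) \<eta> \<longrightarrow>
      chi G \<omega> \<beta> = unit_char \<eta> \<alpha>" by blast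
  fix z assume z: "\<forall>\<omega>\<in>forms G. \<forall>\<beta>\<in>acoset \<Lambda> \<alpha>. uline G \<omega> = acoset (dual G (H1 G)) \<eta> \<longrightarrow> chi G \<omega> \<beta> = z"
  have "\<eta> \<in> forms G" "\<alpha> \<in> acoset \<Lambda> \<alpha>"
    using \<eta>h harmonic_forms plus_subgroup_0[OF \<Lambda>(1)] by (auto simp: mem_acoset_iff)
  then show "z = unit_char \<eta> \<alpha>" using all z uline_harmonic[OF \<eta>h] by metis
qed

lemma K_cls_eq:
  assumes "l \<ge> 1" "\<eta> \<in> harmonic G"
  shows "K_cls G (acoset (dual G (H1 G)) \<eta>) l = (\<Sum>as\<in>circuits G l. unit_char \<eta> (Cab as))"
  unfolding K_cls_def
proof (rule on_class_eq[OF assms(2)])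
  fix \<omega> assume \<omega>: "\<omega> \<in> forms G" "phi1 G \<omega> - \<eta> \<in> dual G (H1 G)"
  show "K G \<omega> l = (\<Sum>as\<in>circuits G l. unit_char \<eta> (Cab as))"
    unfolding K_eq_sum_unit_char[OF assms(1) \<omega>(1)]
    by (intro sum.cong unit_char_dual_cong[OF \<omega>(2)] Cab_in_H1) auto
qed

text \<open>The factor \<open>chi G (- \<omega>) \<alpha>\<close> shifts every circuit class by
  \<open>- \<alpha>\<close>, and orthogonality retains exactly the circuits whose shifted class is
  0.\<close>

lemma Ncirc_eq_integral:
  assumes "l \<ge> 1" "\<alpha> \<in> H1 G"
  shows "of_nat (Ncirc G \<alpha> l) =
    1 / of_real (vol_X G) * (LINT x|dV G. on_class G (\<lambda>\<omega>. chi G (- \<omega>) \<alpha> * K G \<omega> l) x)"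
proof -
  interpret torus "harmonic G" "dual G (H1 G)" by (rule torus_harmonic)
  have diff: "Cab as - \<alpha> \<in> H1 G" if "as \<in> circuits G l" for as
    using that assms(2) Cab_in_H1 plus_subgroup_diff[OF plus_subgroup_H1] by blast
  have g: "on_class G (\<lambda>\<omega>. chi G (- \<omega>) \<alpha> * K G \<omega> l) (acoset (dual G (H1 G)) \<eta>)
      = (\<Sum>as\<in>circuits G l. unit_char \<eta> (Cab as - \<alpha>))" if "\<eta> \<in> harmonic G" for \<eta>
  proof (rule on_class_eq[OF that])
    fix \<omega> assume \<omega>: "\<omega> \<in> forms G" "phi1 G \<omega> - \<eta> \<in> dual G (H1 G)"
    have "chi G (- \<omega>) \<alpha> * K G \<omega> l = (\<Sum>as\<in>circuits G l. unit_char (phi1 G \<omega>) (Cab as - \<alpha>))"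
      unfolding K_eq_sum_unit_char[OF assms(1) \<omega>(1)] chi_minus_eq_unit_char[OF \<omega>(1) assms(2)]
      by (simp add: sum_distrib_left flip: unit_char_add_right)
    also have "\<dots> = (\<Sum>as\<in>circuits G l. unit_char \<eta> (Cab as - \<alpha>))"
      by (intro sum.cong unit_char_dual_cong[OF \<omega>(2)] diff) auto
    finally show "chi G (- \<omega>) \<alpha> * K G \<omega> l = (\<Sum>as\<in>circuits G l. unit_char \<eta> (Cab as - \<alpha>))" .
  qed
  have vol: "vol_X G = measure (torus_measure (harmonic G) (dual G (H1 G))) X"
    by (simp add: vol_X_def dV_def X_grp_def)
  have \<beta>: "Cab as - \<alpha> \<in> harmonic G" "\<And>\<eta>. \<eta> \<in> dual G (H1 G) \<Longrightarrow> \<eta> \<bullet> (Cab as - \<alpha>) \<in> \<int>"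
    if "as \<in> circuits G l" for as
    using diff[OF that] H1_harmonic unfolding dual_eq by blast+
  note int = integral_torus_unit_char_sum[where I = "circuits G l" and \<beta> = "\<lambda>as. Cab as - \<alpha>"
      and g = "on_class G (\<lambda>\<omega>. chi G (- \<omega>) \<alpha> * K G \<omega> l)", OF finite_circuits \<beta> g, folded vol]
  show ?thesis using int unfolding dV_def by (simp add: Ncirc_def)
qed

end

section \<open>Duality for finite quotients\<close>

locale finite_index_sublattice =
  fixes G :: "('v, 'e::finite) pre_digraph" and \<Lambda> :: "(real ^ 'e) set"
  assumes G: "fin_digraph G"
    and \<Lambda>: "subgroup \<Lambda> (add_grp (H1 G))"
    and fin_Q: "finite (carrier (Q_grp G \<Lambda>))"
begin

abbreviation L :: "(real ^ 'e) set" where "L \<equiv> dual G (H1 G)"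

lemma sub: "plus_subgroup \<Lambda>" "\<Lambda> \<subseteq> H1 G"
  using \<Lambda> subgroup_add_grp_iff[OF plus_subgroup_H1] by auto

lemma dual_mono: "L \<subseteq> dual G \<Lambda>"
  using sub(2) by (auto simp: dual_eq)

lemma carrier_Q: "carrier (Q_grp G \<Lambda>) = acoset \<Lambda> ` H1 G"
  by (simp add: Q_grp_def carrier_add_grp_Mod)

lemma carrier_Qhat: "carrier (Qhat_grp G \<Lambda>) = acoset L ` dual G \<Lambda>"
  by (simp add: Qhat_grp_def carrier_add_grp_Mod)

lemma group_Q: "group (Q_grp G \<Lambda>)"
  unfolding Q_grp_def by (rule group_add_grp_Mod[OF plus_subgroup_H1 sub])

lemma group_Qhat: "group (Qhat_grp G \<Lambda>)"
  unfolding Qhat_grp_def by (rule group_add_grp_Mod[OF plus_subgroup_dual plus_subgroup_dual dual_mono])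

lemma order_Q_pos: "Coset.order (Q_grp G \<Lambda>) > 0"
  using monoid.order_gt_0_iff_finite[OF group.is_monoid[OF group_Q]] fin_Q by blast

lemma order_scaleR: "\<alpha> \<in> H1 G \<Longrightarrow> of_nat (Coset.order (Q_grp G \<Lambda>)) *\<^sub>R \<alpha> \<in> \<Lambda>"
  unfolding Q_grp_def by (rule scaleR_order_Mod[OF plus_subgroup_H1 sub])

text \<open>The index of \<Lambda> multiplies every cycle in \<open>H1 G\<close> into \<Lambda>, and
  over the reals it can be divided out again.\<close>

lemma span_sublattice: "harmonic G \<subseteq> span \<Lambda>"
proof -
  have "\<alpha> \<in> span \<Lambda>" if "\<alpha> \<in> H1 G" for \<alpha>
  proof -
    let ?n = "of_nat (Coset.order (Q_grp G \<Lambda>)) :: real"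
    have "(1 / ?n) *\<^sub>R (?n *\<^sub>R \<alpha>) \<in> span \<Lambda>"
      by (intro span_scale span_base order_scaleR that)
    then show ?thesis using order_Q_pos by simp
  qed
  then have "span (H1 G) \<subseteq> span \<Lambda>" by (intro span_minimal subspace_span) blast
  then show ?thesis by (simp add: span_H1)
qed

lemma chi_cls:
  assumes "\<eta> \<in> dual G \<Lambda>" "\<alpha> \<in> H1 G"
  shows "chi_cls G (acoset L \<eta>) (acoset \<Lambda> \<alpha>) = unit_char \<eta> \<alpha>"
  by (rule chi_cls_eq[OF G sub assms])

lemma unit_char_pow_order:
  assumes "\<eta> \<in> dual G \<Lambda>" "\<alpha> \<in> H1 G"
  shows "unit_char \<eta> \<alpha> ^ Coset.order (Q_grp G \<Lambda>) = 1"
proof -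
  have "unit_char \<eta> \<alpha> ^ n = unit_char \<eta> (of_nat n *\<^sub>R \<alpha>)" for n
    by (induction n) (simp_all add: unit_char_add_right scaleR_add_left)
  moreover have "\<eta> \<bullet> (of_nat (Coset.order (Q_grp G \<Lambda>)) *\<^sub>R \<alpha>) \<in> \<int>"
    using order_scaleR[OF assms(2)] assms(1) unfolding dual_eq by blast
  ultimately show ?thesis by (simp only: unit_char_eq_1_iff)
qed

text \<open>A class is determined by the character it induces on the finite group
  \<open>Q_grp G \<Lambda>\<close>, whose values are roots of unity of exponent dividing the order.
  Only finitely many such functions exist.\<close>

lemma finite_Qhat: "finite (carrier (Qhat_grp G \<Lambda>))"
proof (rule finite_imageD)
  let ?n = "Coset.order (Q_grp G \<Lambda>)"
  let ?f = "\<lambda>x. \<lambda>c\<in>carrier (Q_grp G \<Lambda>). chi_cls G x c"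
  have "?f ` carrier (Qhat_grp G \<Lambda>) \<subseteq> Pi\<^sub>E (carrier (Q_grp G \<Lambda>)) (\<lambda>_. {z. z ^ ?n = 1})"
    by (auto simp: carrier_Q carrier_Qhat chi_cls unit_char_pow_order)
  then show "finite (?f ` carrier (Qhat_grp G \<Lambda>))"
    by (rule finite_subset) (use fin_Q order_Q_pos in \<open>auto intro!: finite_PiE finite_roots_unity\<close>)
  show "inj_on ?f (carrier (Qhat_grp G \<Lambda>))"
    unfolding carrier_Qhat
  proof (rule inj_onI)
    fix x y assume "x \<in> acoset L ` dual G \<Lambda>" "y \<in> acoset L ` dual G \<Lambda>" and eq: "?f x = ?f y"
    then obtain \<eta> \<zeta> where x: "x = acoset L \<eta>" "\<eta> \<in> dual G \<Lambda>" and y: "y = acoset L \<zeta>" "\<zeta> \<in> dual G \<Lambda>" by blast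
    have "(\<eta> - \<zeta>) \<bullet> \<alpha> \<in> \<int>" if \<alpha>: "\<alpha> \<in> H1 G" for \<alpha>
    proof -
      have "unit_char \<eta> \<alpha> = unit_char \<zeta> \<alpha>"
        using fun_cong[OF eq, of "acoset \<Lambda> \<alpha>"] x y \<alpha> by (simp add: carrier_Q chi_cls)
      then have "unit_char (\<eta> + - \<zeta>) \<alpha> = 1"
        unfolding unit_char_add_left unit_char_minus by (metis norm_unit_char norm_zero right_inverse zero_neq_one)
      then show ?thesis by (simp add: unit_char_eq_1_iff)
    qed
    then have "\<eta> - \<zeta> \<in> L"
      using plus_subgroup_diff[OF plus_subgroup_dual x(2) y(2)] by (simp add: dual_eq)
    then show "x = y" unfolding x y by (simp add: acoset_eq_iff[OF plus_subgroup_dual])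
  qed
qed

text \<open>One class whose character is nontrivial at \<alpha> makes the sum vanish. For \<alpha>
  outside \<Lambda> such a class comes from the contrapositive of
  \<open>int_comb_double_dual\<close>.\<close>

lemma sum_Qhat:
  assumes \<alpha>: "\<alpha> \<in> H1 G"
  shows "(\<Sum>x\<in>carrier (Qhat_grp G \<Lambda>). chi_cls G x (acoset \<Lambda> \<alpha>))
    = (if \<alpha> \<in> \<Lambda> then of_nat (card (carrier (Qhat_grp G \<Lambda>))) else 0)"
proof (cases "\<alpha> \<in> \<Lambda>")
  case True
  have "chi_cls G x (acoset \<Lambda> \<alpha>) = 1" if "x \<in> carrier (Qhat_grp G \<Lambda>)" for x
    using that True \<alpha> by (auto simp: carrier_Qhat chi_cls unit_char_eq_1_iff) (simp add: dual_eq)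
  then show ?thesis using True by simp
next
  case False
  obtain B where B: "finite B" "independent B" "\<Lambda> = int_comb B" "span B = harmonic G"
    "dual G \<Lambda> = {x \<in> span B. \<forall>b\<in>B. x \<bullet> b \<in> \<int>}"
    using integral_sublattice_basis[OF sub span_sublattice] by blast
  have "\<alpha> \<in> span B" using \<alpha> H1_harmonic B(4) by auto
  then obtain \<eta> where \<eta>: "\<eta> \<in> dual G \<Lambda>" "\<eta> \<bullet> \<alpha> \<notin> \<int>"
    using int_comb_double_dual[OF B(1,2), of \<alpha>] False B(3,5) by blast
  interpret group "Qhat_grp G \<Lambda>" by (rule group_Qhat)
  have "(\<Sum>x\<in>carrier (Qhat_grp G \<Lambda>). chi_cls G x (acoset \<Lambda> \<alpha>)) = 0"
  proof (rule sum_character_eq_0)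
    show "acoset L \<eta> \<in> carrier (Qhat_grp G \<Lambda>)" using \<eta>(1) by (auto simp: carrier_Qhat)
    show "chi_cls G (acoset L \<eta>) (acoset \<Lambda> \<alpha>) \<noteq> 1" using \<eta> \<alpha> by (simp add: chi_cls unit_char_eq_1_iff)
    fix x y assume "x \<in> carrier (Qhat_grp G \<Lambda>)" "y \<in> carrier (Qhat_grp G \<Lambda>)"
    then obtain \<eta> \<zeta> where x: "x = acoset L \<eta>" "\<eta> \<in> dual G \<Lambda>" and y: "y = acoset L \<zeta>" "\<zeta> \<in> dual G \<Lambda>"
      by (auto simp: carrier_Qhat)
    have "x \<otimes>\<^bsub>Qhat_grp G \<Lambda>\<^esub> y = acoset L (\<eta> + \<zeta>)"
      unfolding x(1) y(1) Qhat_grp_def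
      by (rule mult_add_grp_Mod[OF plus_subgroup_dual plus_subgroup_dual dual_mono x(2) y(2)])
    then show "chi_cls G (x \<otimes>\<^bsub>Qhat_grp G \<Lambda>\<^esub> y) (acoset \<Lambda> \<alpha>) = chi_cls G x (acoset \<Lambda> \<alpha>) * chi_cls G y (acoset \<Lambda> \<alpha>)"
      using x y \<alpha> plus_subgroup_add[OF plus_subgroup_dual x(2) y(2)] by (simp add: chi_cls unit_char_add_left)
  qed
  then show ?thesis using False by simp
qed

text \<open>Here separation follows from the definition of the dual: for \<eta> outside
  \<open>L\<close>, some cycle pairs with \<eta> to a non-integer.\<close>

lemma sum_Q:
  assumes \<eta>: "\<eta> \<in> dual G \<Lambda>"
  shows "(\<Sum>c\<in>carrier (Q_grp G \<Lambda>). chi_cls G (acoset L \<eta>) c)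
    = (if \<eta> \<in> L then of_nat (Coset.order (Q_grp G \<Lambda>)) else 0)"
proof (cases "\<eta> \<in> L")
  case True
  have "chi_cls G (acoset L \<eta>) c = 1" if "c \<in> carrier (Q_grp G \<Lambda>)" for c
    using that True \<eta> by (auto simp: carrier_Q chi_cls unit_char_eq_1_iff) (simp add: dual_eq)
  then show ?thesis using True by (simp add: Coset.order_def)
next
  case False
  then obtain \<alpha> where \<alpha>: "\<alpha> \<in> H1 G" "\<eta> \<bullet> \<alpha> \<notin> \<int>" using \<eta> by (auto simp: dual_eq)
  interpret group "Q_grp G \<Lambda>" by (rule group_Q)
  have "(\<Sum>c\<in>carrier (Q_grp G \<Lambda>). chi_cls G (acoset L \<eta>) c) = 0"
  proof (rule sum_character_eq_0)
    show "acoset \<Lambda> \<alpha> \<in> carrier (Q_grp G \<Lambda>)" using \<alpha>(1) by (auto simp: carrier_Q)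
    show "chi_cls G (acoset L \<eta>) (acoset \<Lambda> \<alpha>) \<noteq> 1" using \<eta> \<alpha> by (simp add: chi_cls unit_char_eq_1_iff)
    fix c d assume "c \<in> carrier (Q_grp G \<Lambda>)" "d \<in> carrier (Q_grp G \<Lambda>)"
    then obtain \<alpha> \<beta> where c: "c = acoset \<Lambda> \<alpha>" "\<alpha> \<in> H1 G" and d: "d = acoset \<Lambda> \<beta>" "\<beta> \<in> H1 G"
      by (auto simp: carrier_Q)
    have "c \<otimes>\<^bsub>Q_grp G \<Lambda>\<^esub> d = acoset \<Lambda> (\<alpha> + \<beta>)"
      unfolding c(1) d(1) Q_grp_def by (rule mult_add_grp_Mod[OF plus_subgroup_H1 sub c(2) d(2)])
    then show "chi_cls G (acoset L \<eta>) (c \<otimes>\<^bsub>Q_grp G \<Lambda>\<^esub> d) = chi_cls G (acoset L \<eta>) c * chi_cls G (acoset L \<eta>) d"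
      using c d \<eta> plus_subgroup_add[OF plus_subgroup_H1 c(2) d(2)] by (simp add: chi_cls unit_char_add_right)
  qed
  then show ?thesis using False by simp
qed

text \<open>Both sides are the sum of all character values, evaluated in either order.\<close>
lemma card_Qhat: "card (carrier (Qhat_grp G \<Lambda>)) = Coset.order (Q_grp G \<Lambda>)"
proof -
  let ?Q = "carrier (Q_grp G \<Lambda>)" and ?Q' = "carrier (Qhat_grp G \<Lambda>)"
  have Q0: "acoset \<Lambda> 0 \<in> ?Q" using plus_subgroup_0[OF plus_subgroup_H1] by (auto simp: carrier_Q)
  have Q'0: "acoset L 0 \<in> ?Q'" using plus_subgroup_0[OF plus_subgroup_dual] by (auto simp: carrier_Qhat)
  have "(\<Sum>x\<in>?Q'. \<Sum>c\<in>?Q. chi_cls G x c)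
      = (\<Sum>x\<in>?Q'. if x = acoset L 0 then of_nat (Coset.order (Q_grp G \<Lambda>)) else 0)"
  proof (rule sum.cong[OF refl])
    fix x assume "x \<in> ?Q'"
    then obtain \<eta> where "x = acoset L \<eta>" "\<eta> \<in> dual G \<Lambda>" by (auto simp: carrier_Qhat)
    then show "(\<Sum>c\<in>?Q. chi_cls G x c) = (if x = acoset L 0 then of_nat (Coset.order (Q_grp G \<Lambda>)) else 0)"
      using sum_Q by (simp add: acoset_eq_iff[OF plus_subgroup_dual])
  qed
  also have "\<dots> = of_nat (Coset.order (Q_grp G \<Lambda>))" using finite_Qhat Q'0 by simp
  finally have 1: "(\<Sum>x\<in>?Q'. \<Sum>c\<in>?Q. chi_cls G x c) = of_nat (Coset.order (Q_grp G \<Lambda>))" .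
  have "(\<Sum>c\<in>?Q. \<Sum>x\<in>?Q'. chi_cls G x c) = (\<Sum>c\<in>?Q. if c = acoset \<Lambda> 0 then of_nat (card ?Q') else 0)"
  proof (rule sum.cong[OF refl])
    fix c assume "c \<in> ?Q"
    then obtain \<alpha> where "c = acoset \<Lambda> \<alpha>" "\<alpha> \<in> H1 G" by (auto simp: carrier_Q)
    then show "(\<Sum>x\<in>?Q'. chi_cls G x c) = (if c = acoset \<Lambda> 0 then of_nat (card ?Q') else 0)"
      using sum_Qhat by (simp add: acoset_eq_iff[OF sub(1)])
  qed
  also have "\<dots> = of_nat (card ?Q')" using fin_Q Q0 by simp
  finally have "of_nat (card ?Q') = (of_nat (Coset.order (Q_grp G \<Lambda>)) :: complex)"
    using 1 sum.swap[of "chi_cls G" ?Q ?Q'] by simp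
  then show ?thesis by (simp only: of_nat_eq_iff)
qed

lemma Ncirc_cls_acoset: "Ncirc_cls G (acoset \<Lambda> \<alpha>) l = card {as \<in> circuits G l. Cab as - \<alpha> \<in> \<Lambda>}"
  by (simp add: Ncirc_cls_def mem_acoset_iff)

lemma K_cls_Qhat:
  assumes "l \<ge> 1" "\<eta> \<in> dual G \<Lambda>"
  shows "K_cls G (acoset L \<eta>) l = (\<Sum>as\<in>circuits G l. unit_char \<eta> (Cab as))"
  by (rule K_cls_eq[OF G assms(1)]) (use assms(2) in \<open>simp add: dual_eq\<close>)

lemma K_cls_eq_sum_Ncirc_cls:
  assumes "l \<ge> 1" "x \<in> carrier (Qhat_grp G \<Lambda>)"
  shows "K_cls G x l = (\<Sum>c\<in>carrier (Q_grp G \<Lambda>). chi_cls G x c * of_nat (Ncirc_cls G c l))"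
proof -
  obtain \<eta> where \<eta>: "x = acoset L \<eta>" "\<eta> \<in> dual G \<Lambda>" using assms(2) by (auto simp: carrier_Qhat)
  have Cab: "acoset \<Lambda> (Cab as) \<in> carrier (Q_grp G \<Lambda>)" if "as \<in> circuits G l" for as
    unfolding carrier_Q by (rule imageI) (rule Cab_in_H1[OF that])
  have "K_cls G x l = (\<Sum>as\<in>circuits G l. chi_cls G x (acoset \<Lambda> (Cab as)))"
    unfolding \<eta>(1) K_cls_Qhat[OF assms(1) \<eta>(2)] by (intro sum.cong refl) (simp add: chi_cls[OF \<eta>(2) Cab_in_H1])
  also have "\<dots> = (\<Sum>c\<in>carrier (Q_grp G \<Lambda>). \<Sum>as | as \<in> circuits G l \<and> acoset \<Lambda> (Cab as) = c.
      chi_cls G x (acoset \<Lambda> (Cab as)))"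
    by (rule sum.group[symmetric, OF finite_circuits fin_Q]) (use Cab in blast)
  also have "\<dots> = (\<Sum>c\<in>carrier (Q_grp G \<Lambda>). chi_cls G x c * of_nat (Ncirc_cls G c l))"
  proof (rule sum.cong[OF refl])
    fix c assume "c \<in> carrier (Q_grp G \<Lambda>)"
    then obtain \<alpha> where "c = acoset \<Lambda> \<alpha>" unfolding carrier_Q by blast
    then have "{as \<in> circuits G l. acoset \<Lambda> (Cab as) = c} = {as \<in> circuits G l. Cab as \<in> c}"
      by (simp add: mem_acoset_iff acoset_eq_iff[OF sub(1)])
    moreover have "(\<Sum>as | as \<in> circuits G l \<and> acoset \<Lambda> (Cab as) = c. chi_cls G x (acoset \<Lambda> (Cab as)))
        = (\<Sum>as | as \<in> circuits G l \<and> acoset \<Lambda> (Cab as) = c. chi_cls G x c)"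
      by (rule sum.cong) auto
    ultimately show "(\<Sum>as | as \<in> circuits G l \<and> acoset \<Lambda> (Cab as) = c. chi_cls G x (acoset \<Lambda> (Cab as)))
        = chi_cls G x c * of_nat (Ncirc_cls G c l)"
      by (simp add: Ncirc_cls_def)
  qed
  finally show ?thesis .
qed

lemma Ncirc_cls_eq_sum_K_cls:
  assumes "l \<ge> 1" "c \<in> carrier (Q_grp G \<Lambda>)"
  shows "of_nat (Ncirc_cls G c l) = 1 / of_nat (Coset.order (Q_grp G \<Lambda>)) *
    (\<Sum>x\<in>carrier (Qhat_grp G \<Lambda>). chi_cls G (inv\<^bsub>X_grp G\<^esub> x) c * K_cls G x l)"
proof -
  obtain \<alpha> where \<alpha>: "c = acoset \<Lambda> \<alpha>" "\<alpha> \<in> H1 G" using assms(2) by (auto simp: carrier_Q)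
  have diff: "Cab as - \<alpha> \<in> H1 G" if "as \<in> circuits G l" for as
    by (rule plus_subgroup_diff[OF plus_subgroup_H1 Cab_in_H1[OF that] \<alpha>(2)])
  have summand: "chi_cls G (inv\<^bsub>X_grp G\<^esub> x) c * K_cls G x l = (\<Sum>as\<in>circuits G l. chi_cls G x (acoset \<Lambda> (Cab as - \<alpha>)))"
    if x: "x \<in> carrier (Qhat_grp G \<Lambda>)" for x
  proof -
    obtain \<eta> where \<eta>: "x = acoset L \<eta>" "\<eta> \<in> dual G \<Lambda>"
      using x by (auto simp: carrier_Qhat)
    \<comment> \<open>The inverse formed in the larger group \<open>X_grp G\<close> is the coset of
      \<open>- \<eta>\<close>, which again lies in the dual of \<Lambda>, so \<open>chi_cls\<close>
      evaluates it.\<close>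
    have "inv\<^bsub>X_grp G\<^esub> x = acoset L (- \<eta>)"
      unfolding X_grp_def \<eta>(1) using \<eta>(2)
      by (intro inv_add_grp_Mod plus_subgroup_harmonic plus_subgroup_dual dual_harmonic) (simp add: dual_eq)
    then have "chi_cls G (inv\<^bsub>X_grp G\<^esub> x) c = unit_char \<eta> (- \<alpha>)"
      using chi_cls[OF plus_subgroup_neg[OF plus_subgroup_dual \<eta>(2)] \<alpha>(2)] \<alpha>(1) by (simp add: unit_char_minus)
    then show ?thesis
      unfolding \<eta>(1) K_cls_Qhat[OF assms(1) \<eta>(2)]
      by (simp add: sum_distrib_left chi_cls[OF \<eta>(2) diff] flip: unit_char_add_right)
  qed
  have "(\<Sum>x\<in>carrier (Qhat_grp G \<Lambda>). chi_cls G (inv\<^bsub>X_grp G\<^esub> x) c * K_cls G x l)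
      = (\<Sum>x\<in>carrier (Qhat_grp G \<Lambda>). \<Sum>as\<in>circuits G l. chi_cls G x (acoset \<Lambda> (Cab as - \<alpha>)))"
    by (rule sum.cong[OF refl summand])
  also have "\<dots> = (\<Sum>as\<in>circuits G l. \<Sum>x\<in>carrier (Qhat_grp G \<Lambda>). chi_cls G x (acoset \<Lambda> (Cab as - \<alpha>)))"
    by (rule sum.swap)
  \<comment> \<open>Orthogonality produces the number of characters; \<open>card_Qhat\<close>
    converts it into the order of the quotient.\<close>
  also have "\<dots> = (\<Sum>as\<in>circuits G l. if Cab as - \<alpha> \<in> \<Lambda> then of_nat (Coset.order (Q_grp G \<Lambda>)) else 0)"
    by (intro sum.cong refl) (simp add: sum_Qhat[OF diff] card_Qhat)
  also have "\<dots> = of_nat (Ncirc_cls G c l) * of_nat (Coset.order (Q_grp G \<Lambda>))"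
    unfolding \<alpha>(1) Ncirc_cls_acoset by (simp add: sum.If_cases finite_circuits Int_def)
  finally show ?thesis using order_Q_pos by simp
qed

end

theorem theorem3p12:
  fixes G :: "('v, 'e::finite) pre_digraph"
  assumes "fin_digraph G" and "Digraph_Component.connected G"
  shows
    "(\<forall>l\<ge>1.
        (\<forall>\<omega>\<in>forms G. ((\<lambda>\<alpha>. chi G \<omega> \<alpha> * of_nat (Ncirc G \<alpha> l)) has_sum K G \<omega> l) (H1 G)) \<and>
        (\<forall>\<alpha>\<in>H1 G. of_nat (Ncirc G \<alpha> l) =
           1 / of_real (vol_X G) *
           (LINT x|dV G. on_class G (\<lambda>\<omega>. chi G (- \<omega>) \<alpha> * K G \<omega> l) x))) \<and>
     (\<forall>\<Lambda>. subgroup \<Lambda> (add_grp (H1 G)) \<and> finite (carrier (Q_grp G \<Lambda>)) \<longrightarrow>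
        (\<forall>l\<ge>1.
           (\<forall>x\<in>carrier (Qhat_grp G \<Lambda>).
              K_cls G x l = (\<Sum>c\<in>carrier (Q_grp G \<Lambda>). chi_cls G x c * of_nat (Ncirc_cls G c l))) \<and>
           (\<forall>c\<in>carrier (Q_grp G \<Lambda>). of_nat (Ncirc_cls G c l) =
              1 / of_nat (Coset.order (Q_grp G \<Lambda>)) *
              (\<Sum>x\<in>carrier (Qhat_grp G \<Lambda>).
                 chi_cls G (inv\<^bsub>X_grp G\<^esub> x) c * K_cls G x l))))"
proof (intro conjI allI impI ballI; (elim conjE)?)
  fix \<Lambda> :: "(real ^ 'e) set" and l :: nat
  assume *: "subgroup \<Lambda> (add_grp (H1 G))" "finite (carrier (Q_grp G \<Lambda>))" and l: "1 \<le> l"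
  interpret finite_index_sublattice G \<Lambda> by (rule finite_index_sublattice.intro) fact+
  show "K_cls G x l = (\<Sum>c\<in>carrier (Q_grp G \<Lambda>). chi_cls G x c * of_nat (Ncirc_cls G c l))"
    if "x \<in> carrier (Qhat_grp G \<Lambda>)" for x
    by (rule K_cls_eq_sum_Ncirc_cls[OF l that])
  show "of_nat (Ncirc_cls G c l) = 1 / of_nat (Coset.order (Q_grp G \<Lambda>)) *
      (\<Sum>x\<in>carrier (Qhat_grp G \<Lambda>). chi_cls G (inv\<^bsub>X_grp G\<^esub> x) c * K_cls G x l)"
    if "c \<in> carrier (Q_grp G \<Lambda>)" for c
    by (rule Ncirc_cls_eq_sum_K_cls[OF l that])
next
  fix l :: nat assume l: "1 \<le> l"
  show "((\<lambda>\<alpha>. chi G \<omega> \<alpha> * of_nat (Ncirc G \<alpha> l)) has_sum K G \<omega> l) (H1 G)" for \<omega>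
    by (rule has_sum_circuits[OF l])
  show "of_nat (Ncirc G \<alpha> l) = 1 / of_real (vol_X G) *
      (LINT x|dV G. on_class G (\<lambda>\<omega>. chi G (- \<omega>) \<alpha> * K G \<omega> l) x)" if "\<alpha> \<in> H1 G" for \<alpha>
    by (rule Ncirc_eq_integral[OF assms(1) l that])
qed

end
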